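(* Let $\Lambda\subseteq\mathbb{C}\simeq\mathbb{R}^2$ be a set of stable sampling for $\mathcal{F}_\pi(\mathbb{C})$, and let $f\in L^2(\mathbb{R})$. If there exists a constant $C\ge 0$ such that $$|\mathcal{G}f(\lambda)|\le Ce^{-\frac{\pi}{2}|\lambda|^2},\quad \lambda\in\Lambda,$$ then $f(x)=ce^{-\pi x^2}$ for some $c\in\mathbb{C}$.
   Context: $L^2(\mathbb{R})$ denotes the complex-valued square-integrable functions on $\mathbb{R}$. The Gabor transform of $f\in L^2(\mathbb{R})$ is $\mathcal{G}f(x,\omega)=\int_{\mathbb{R}}f(t)e^{-\pi(t-x)^2}e^{-2\pi i\omega t}\,dt$ for $(x,\omega)\in\mathbb{R}^2$; $\mathbb{R}^2$ is identified with $\mathbb{C}$ via $(x,\omega)\simeq x+i\omega$. For $\alpha>0$, $\mathcal{F}_\alpha(\mathbb{C})$ is the Fock space of entire functions $F$ with $\|F\|_{\mathcal{F}_\alpha(\mathbb{C})}^2=\frac{\alpha}{\pi}\int_{\mathbb{C}}|F(z)|^2e^{-\alpha|z|^2}\,dA(z)<\infty$ ($dA$ Lebesgue area measure). A discrete set $\Gamma\subseteq\mathbb{C}$ is a set of stable sampling for $\mathcal{F}_\alpha(\mathbb{C})$ if there are constants $A,B>0$ such that $A\|F\|_{\mathcal{F}_\alpha(\mathbb{C})}^2\le\sum_{\gamma\in\Gamma}e^{-\alpha|\gamma|^2}|F(\gamma)|^2\le B\|F\|_{\mathcal{F}_\alpha(\mathbb{C})}^2$ for all $F\in\mathcal{F}_\alpha(\mathbb{C})$.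 Equality of $f$ with a function is understood as equality in $L^2(\mathbb{R})$ (almost everywhere). *)

theory Defs
  imports "HOL-Analysis.Analysis"
begin

text \<open>Elements of the \<open>L\<^sup>2\<close> space on the real line are represented by Lebesgue measurable
  functions; equality in the space is equality almost everywhere.\<close>

definition L2_real :: "(real \<Rightarrow> complex) set" where
  "L2_real = {f. f \<in> borel_measurable lebesgue \<and> integrable lebesgue (\<lambda>t. (norm (f t))\<^sup>2)}"

definition gabor_transform :: "(real \<Rightarrow> complex) \<Rightarrow> real \<Rightarrow> real \<Rightarrow> complex" where
  "gabor_transform f x \<omega> =
     (LINT t|lebesgue. f t * of_real (exp (- pi * (t - x)\<^sup>2)) * exp (- 2 * of_real pi * \<i> * of_real \<omega> * of_real t))"

definition fock_space :: "real \<Rightarrow> (complex \<Rightarrow> complex) set" where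
  "fock_space \<alpha> = {F. F holomorphic_on UNIV \<and>
     integrable lebesgue (\<lambda>z. (norm (F z))\<^sup>2 * exp (- \<alpha> * (norm z)\<^sup>2))}"

definition fock_norm :: "real \<Rightarrow> (complex \<Rightarrow> complex) \<Rightarrow> real" where
  "fock_norm \<alpha> F = sqrt (\<alpha> / pi * (LINT z|lebesgue. (norm (F z))\<^sup>2 * exp (- \<alpha> * (norm z)\<^sup>2)))"

text \<open>Since \<^const>\<open>infsum\<close> is 0 for a divergent family, finiteness of the sampling sum, which is
  part of the upper inequality, is stated as summability.\<close>

definition stable_sampling :: "real \<Rightarrow> complex set \<Rightarrow> bool" where
  "stable_sampling \<alpha> \<Gamma> \<longleftrightarrow> discrete \<Gamma> \<and>
     (\<exists>A>0. \<exists>B>0. \<forall>F\<in>fock_space \<alpha>.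
        (\<lambda>\<gamma>. exp (- \<alpha> * (norm \<gamma>)\<^sup>2) * (norm (F \<gamma>))\<^sup>2) summable_on \<Gamma> \<and>
        A * (fock_norm \<alpha> F)\<^sup>2 \<le> (\<Sum>\<^sub>\<infinity>\<gamma>\<in>\<Gamma>. exp (- \<alpha> * (norm \<gamma>)\<^sup>2) * (norm (F \<gamma>))\<^sup>2) \<and>
        (\<Sum>\<^sub>\<infinity>\<gamma>\<in>\<Gamma>. exp (- \<alpha> * (norm \<gamma>)\<^sup>2) * (norm (F \<gamma>))\<^sup>2) \<le> B * (fock_norm \<alpha> F)\<^sup>2)"

end

theory Submission
  imports Defs "HOL-Probability.Probability" "HOL-Complex_Analysis.Complex_Analysis"
begin

text \<open>
  Up to the Gaussian factor \<open>exp (- pi / 2 * |z|\<^sup>2)\<close>, the modulus of the Gabor transform is the modulus of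
  the Bargmann transform \<open>G\<close>, an entire function in the Fock space. In these terms the hypothesis says
  that \<open>G\<close> is bounded by a constant \<open>C\<close> on the sampling set, and the conclusion says that \<open>G\<close> is
  constant. So the heart of the matter is a Liouville theorem
  (\<open>bounded_on_sampling_set_imp_constant\<close>): an element of the Fock space that is bounded on a set of
  stable sampling is constant.

  If the product \<open>P * G\<close> is in the Fock space, then sampling it from below and sampling \<open>P\<close> from above
  gives \<open>\<parallel>P * G\<parallel>\<^sup>2 \<le> (C\<^sup>2 * B / A) * \<parallel>P\<parallel>\<^sup>2\<close>, because \<open>|G| \<le> C\<close> on the sampling set. Apply this to the
  normalised reproducing kernels \<open>P = exp (pi * cnj w * z - pi / 2 * |w|\<^sup>2)\<close>, which all have the same
  norm and whose weighted modulus is a Gaussian bump at \<open>w\<close>. The result bounds the mean of \<open>|G|\<^sup>2\<close>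
  around \<open>w\<close>, uniformly in \<open>w\<close>. Hence \<open>G\<close> is bounded on the whole plane and Liouville's theorem
  applies.

  The difficulty is that \<open>P * G\<close> need not be in the Fock space when \<open>G\<close> is merely an element of it. It
  is enough to know that every \<open>z ^ n * G\<close> is, since the inequality for \<open>P = z ^ n\<close> can then be summed to
  one for exponentials. This reduces to a regularity statement (\<open>fock_energy_mult_z_finite\<close>): if \<open>F\<close>
  is in the Fock space and the samples of \<open>z * F\<close> are square summable, then \<open>z * F\<close> is in the Fock
  space. It is proved with difference quotients. The Weyl shifts
  \<open>W c F z = exp (pi * cnj c * z - pi / 2 * |c|\<^sup>2) * F (z - c)\<close> preserve the norm, so the sampling
  inequality applies to \<open>W c F - F\<close>; the samples of that difference are \<open>O(|c|)\<close>, because the phase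
  of the Weyl shift costs a factor \<open>|c| * |l|\<close> at a sampling point \<open>l\<close>, while the rest is controlled by
  a local mean value estimate. Letting \<open>c\<close> tend to \<open>0\<close> along the real and the imaginary axis shows that
  \<open>pi * z * F - F'\<close> and \<open>pi * z * F + F'\<close> have finite norm, and so has their sum.

  What remains concerns the Bargmann transform: it maps into the Fock space by the inequality half of
  Plancherel's theorem, and a signal whose Bargmann transform is constant is a Gaussian because an
  integrable function is determined by its Fourier transform (Levy's uniqueness theorem).
\<close>

section \<open>Lebesgue measure on the complex plane and square contours\<close>

lemma measurable_Complex [measurable]: "(\<lambda>(x,y). Complex x y) \<in> borel_measurable (lborel \<Otimes>\<^sub>M lborel)"
  unfolding Complex_eq by measurable

lemma lborel_complex_eq: "(lborel :: complex measure) = distr (lborel \<Otimes>\<^sub>M lborel) borel (\<lambda>(x,y). Complex x y)"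
proof (rule lborel_eqI, goal_cases)
  case (1 l u)
  have le: "Re l \<le> Re u" "Im l \<le> Im u"
    using 1[of 1] 1[of \<i>] by (auto simp: Basis_complex_def)
  have "emeasure (distr (lborel \<Otimes>\<^sub>M lborel) borel (\<lambda>(x,y). Complex x y)) (box l u)
    = emeasure (lborel \<Otimes>\<^sub>M lborel) ((\<lambda>(x,y). Complex x y) -` box l u \<inter> space (lborel \<Otimes>\<^sub>M lborel))"
    by (rule emeasure_distr[OF measurable_Complex]) auto
  also have "(\<lambda>(x,y). Complex x y) -` box l u \<inter> space (lborel \<Otimes>\<^sub>M lborel) = {Re l<..<Re u} \<times> {Im l<..<Im u}"
    by (auto simp: in_box_complex_iff space_pair_measure)
  also have "emeasure (lborel \<Otimes>\<^sub>M lborel) \<dots> = ennreal (Re u - Re l) * ennreal (Im u - Im l)"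
    using le by (subst lborel.emeasure_pair_measure_Times) auto
  also have "\<dots> = (\<Prod>b\<in>Basis. (u - l) \<bullet> b)"
    using le by (auto simp: Basis_complex_def ennreal_mult)
  finally show ?case by simp
qed simp

lemma nn_integral_lborel_complex:
  assumes [measurable]: "f \<in> borel_measurable (borel :: complex measure)"
  shows "(\<integral>\<^sup>+z. f z \<partial>lborel) = (\<integral>\<^sup>+x. \<integral>\<^sup>+y. f (Complex x y) \<partial>lborel \<partial>lborel)"
proof -
  have "(\<integral>\<^sup>+z. f z \<partial>lborel) = (\<integral>\<^sup>+p. f (Complex (fst p) (snd p)) \<partial>(lborel \<Otimes>\<^sub>M lborel))"
    by (subst lborel_complex_eq, subst nn_integral_distr) (auto simp: case_prod_unfold)
  also have "\<dots> = (\<integral>\<^sup>+x. \<integral>\<^sup>+y. f (Complex x y) \<partial>lborel \<partial>lborel)"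
    using measurable_Complex by (subst lborel.nn_integral_fst[symmetric]) (auto simp: case_prod_unfold)
  finally show ?thesis .
qed

lemma nn_integral_lborel_complex':
  assumes [measurable]: "f \<in> borel_measurable (borel :: complex measure)"
  shows "(\<integral>\<^sup>+z. f z \<partial>lborel) = (\<integral>\<^sup>+y. \<integral>\<^sup>+x. f (Complex x y) \<partial>lborel \<partial>lborel)"
proof -
  have [measurable]: "(\<lambda>p. f (Complex (fst p) (snd p))) \<in> borel_measurable (lborel \<Otimes>\<^sub>M lborel)"
    using measurable_Complex by (auto simp: case_prod_unfold intro: measurable_compose)
  show ?thesis
    unfolding nn_integral_lborel_complex[OF assms]
    by (rule lborel_pair.Fubini'[symmetric]) (auto simp: case_prod_unfold)
qed

lemma nn_integral_lborel_translate:
  assumes [measurable]: "f \<in> borel_measurable (borel :: 'a::euclidean_space measure)"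
  shows "(\<integral>\<^sup>+z. f (c + z) \<partial>lborel) = (\<integral>\<^sup>+z. f z \<partial>lborel)"
  by (subst lborel_distr_plus[symmetric, of c]) (simp add: nn_integral_distr)

lemma norm_contour_integral_linepath_le:
  assumes [measurable]: "f \<in> borel_measurable borel" and cont: "continuous_on (closed_segment p q) f"
  shows "ennreal (norm (contour_integral (linepath p q) f)) \<le>
    (\<integral>\<^sup>+t. ennreal (norm (f (linepath p q t)) * norm (q - p)) * indicator {0..1} t \<partial>lborel)"
proof -
  have c: "continuous_on {0..1} (\<lambda>t. f (linepath p q t) * (q - p))"
    by (intro continuous_intros continuous_on_compose2[OF cont]) (auto simp: linepath_in_path)
  have i: "set_integrable lborel {0..1} (\<lambda>t. f (linepath p q t) * (q - p))"
    by (rule borel_integrable_atLeastAtMost') (rule c)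
  have "contour_integral (linepath p q) f = integral {0..1} (\<lambda>t. f (linepath p q t) * (q - p))"
    by (simp add: contour_integral_integral)
  also have "\<dots> = (LINT t:{0..1}|lborel. f (linepath p q t) * (q - p))"
    by (rule set_borel_integral_eq_integral(2)[OF i, symmetric])
  also have "ennreal (norm \<dots>) \<le> (\<integral>\<^sup>+t. ennreal (norm (indicator {0..1} t *\<^sub>R (f (linepath p q t) * (q - p)))) \<partial>lborel)"
    unfolding set_lebesgue_integral_def
    by (rule integral_norm_bound_ennreal) (use i in \<open>simp add: set_integrable_def\<close>)
  also have "\<dots> = (\<integral>\<^sup>+t. ennreal (norm (f (linepath p q t)) * norm (q - p)) * indicator {0..1} t \<partial>lborel)"
    by (intro nn_integral_cong) (auto simp: norm_mult indicator_def)
  finally show ?thesis .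
qed

text \<open>Bounds by Lebesgue integrals over the coordinates, rather than over the parameter of the path, are
  what allows contour integrals to be averaged over a family of squares by Tonelli's theorem. The
  endpoints come in either order because a closed square is traversed in both directions.\<close>

lemma norm_contour_integral_horizontal_le:
  assumes m[measurable]: "f \<in> borel_measurable borel" and cont: "continuous_on (closed_segment (Complex a y) (Complex b y)) f"
    and ne: "a \<noteq> b"
  shows "ennreal (norm (contour_integral (linepath (Complex a y) (Complex b y)) f)) \<le>
    (\<integral>\<^sup>+x. ennreal (norm (f (Complex x y))) * indicator {min a b..max a b} x \<partial>lborel)"
proof -
  have [measurable]: "(\<lambda>x. Complex x y) \<in> borel_measurable borel"
    unfolding Complex_eq by measurable
  have "norm (Complex b y - Complex a y) = \<bar>b - a\<bar>"
    by (simp add: cmod_def)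
  then have "ennreal (norm (contour_integral (linepath (Complex a y) (Complex b y)) f)) \<le>
    (\<integral>\<^sup>+t. ennreal (norm (f (linepath (Complex a y) (Complex b y) t)) * \<bar>b - a\<bar>) * indicator {0..1} t \<partial>lborel)"
    using norm_contour_integral_linepath_le[OF m cont] by simp
  also have "\<dots> = (\<integral>\<^sup>+t. ennreal \<bar>b - a\<bar> * (ennreal (norm (f (Complex (a + (b-a) * t) y))) *
        indicator {min a b..max a b} (a + (b-a) * t)) \<partial>lborel)"
  proof (rule nn_integral_cong)
    fix t :: real
    have "linepath (Complex a y) (Complex b y) t = Complex (a + (b-a) * t) y"
      by (simp add: linepath_def complex_eq_iff algebra_simps)
    moreover have "indicator {0..1} t = (indicator {min a b..max a b} (a + (b-a) * t) :: ennreal)"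
    proof -
      have "t \<in> {0..1} \<longleftrightarrow> a + (b-a) * t \<in> {min a b..max a b}"
      proof (cases "a < b")
        case True
        then have "0 < b - a" by simp
        then have "(b-a) * t \<le> (b-a) * 1 \<longleftrightarrow> t \<le> 1" "(b-a) * 0 \<le> (b-a) * t \<longleftrightarrow> 0 \<le> t"
          by (simp_all only: mult_le_cancel_left_pos)
        moreover have "a + u \<in> {min a b..max a b} \<longleftrightarrow> (b-a) * 0 \<le> u \<and> u \<le> (b-a) * 1" for u
          using True by (auto simp: min_def max_def)
        ultimately show ?thesis by simp
      next
        case False
        with ne have "b - a < 0" by simp
        then have "(b-a) * 1 \<le> (b-a) * t \<longleftrightarrow> t \<le> 1" "(b-a) * t \<le> (b-a) * 0 \<longleftrightarrow> 0 \<le> t"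
          by (simp_all only: mult_le_cancel_left_neg)
        moreover have "a + u \<in> {min a b..max a b} \<longleftrightarrow> u \<le> (b-a) * 0 \<and> (b-a) * 1 \<le> u" for u
          using False ne by (auto simp: min_def max_def)
        ultimately show ?thesis by simp
      qed
      then show ?thesis by (simp add: indicator_def)
    qed
    ultimately show "ennreal (norm (f (linepath (Complex a y) (Complex b y) t)) * \<bar>b - a\<bar>) * indicator {0..1} t
      = ennreal \<bar>b - a\<bar> * (ennreal (norm (f (Complex (a + (b-a) * t) y))) *
        indicator {min a b..max a b} (a + (b-a) * t))"
      by (simp add: ennreal_mult mult_ac)
  qed
  also have "\<dots> = (\<integral>\<^sup>+x. ennreal (norm (f (Complex x y))) * indicator {min a b..max a b} x \<partial>lborel)"
    using ne by (subst nn_integral_cmult, measurable, subst nn_integral_real_affine[of _ "b-a" a]) auto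
  finally show ?thesis .
qed

text \<open>The vertical case is the horizontal one for the function rotated by \<open>\<i>\<close>.\<close>

lemma norm_contour_integral_vertical_le:
  assumes m[measurable]: "f \<in> borel_measurable borel" and cont: "continuous_on (closed_segment (Complex x a) (Complex x b)) f"
    and ne: "a \<noteq> b"
  shows "ennreal (norm (contour_integral (linepath (Complex x a) (Complex x b)) f)) \<le>
    (\<integral>\<^sup>+y. ennreal (norm (f (Complex x y))) * indicator {min a b..max a b} y \<partial>lborel)"
proof -
  let ?g = "\<lambda>z. f (\<i> * z)"
  have img: "(\<lambda>z. \<i> * z) ` closed_segment (Complex a (-x)) (Complex b (-x)) = closed_segment (Complex x a) (Complex x b)"
  proof -
    have "linear (\<lambda>z. \<i> * z)"
      by (simp add: bounded_linear.linear bounded_linear_mult_right)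
    moreover have "\<i> * Complex a (-x) = Complex x a" "\<i> * Complex b (-x) = Complex x b"
      by (simp_all add: complex_eq_iff)
    ultimately show ?thesis
      by (metis closed_segment_linear_image)
  qed
  have "continuous_on (closed_segment (Complex a (-x)) (Complex b (-x))) ?g"
    by (intro continuous_on_compose2[OF cont] continuous_intros) (use img in auto)
  then have "ennreal (norm (contour_integral (linepath (Complex a (-x)) (Complex b (-x))) ?g)) \<le>
    (\<integral>\<^sup>+y. ennreal (norm (?g (Complex y (-x)))) * indicator {min a b..max a b} y \<partial>lborel)"
    by (intro norm_contour_integral_horizontal_le ne) auto
  moreover have "contour_integral (linepath (Complex x a) (Complex x b)) f = \<i> * contour_integral (linepath (Complex a (-x)) (Complex b (-x))) ?g"
  proof -
    have "linepath (Complex x a) (Complex x b) t = \<i> * linepath (Complex a (-x)) (Complex b (-x)) t" for t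
      by (simp add: linepath_def complex_eq_iff algebra_simps)
    moreover have "Complex x b - Complex x a = \<i> * (Complex b (-x) - Complex a (-x))"
      by (simp add: complex_eq_iff)
    ultimately have "contour_integral (linepath (Complex x a) (Complex x b)) f =
        integral {0..1} (\<lambda>t. \<i> * (?g (linepath (Complex a (-x)) (Complex b (-x)) t) * (Complex b (-x) - Complex a (-x))))"
      by (simp add: contour_integral_integral mult_ac)
    also have "\<dots> = \<i> * contour_integral (linepath (Complex a (-x)) (Complex b (-x))) ?g"
      by (subst integral_mult_right) (simp add: contour_integral_integral)
    finally show ?thesis .
  qed
  moreover have "\<i> * Complex y (-x) = Complex x y" for y
    by (simp add: complex_eq_iff)
  ultimately show ?thesis by (simp add: norm_mult)
qed

text \<open>Cauchy's integral formula on the square with vertices \<open>\<plusminus>r \<plusminus> \<i> * r\<close>. Squares are used instead of circles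
  because their sides are parallel to the axes, so that averaging over \<open>r\<close> needs only Tonelli's
  theorem and no polar coordinates. The factor \<open>1 / z\<close> is at most \<open>1\<close> on the contour as \<open>r \<ge> 1\<close>.\<close>

lemma norm_at_0_le_square_integrals:
  assumes h: "h holomorphic_on UNIV" and r: "1 \<le> r" "r \<le> 2"
  shows "ennreal (2 * pi * norm (h 0)) \<le>
    (\<integral>\<^sup>+x. ennreal (norm (h (Complex x (-r)))) * indicator {-2..2} x \<partial>lborel) +
    (\<integral>\<^sup>+y. ennreal (norm (h (Complex r y))) * indicator {-2..2} y \<partial>lborel) +
    (\<integral>\<^sup>+x. ennreal (norm (h (Complex x r))) * indicator {-2..2} x \<partial>lborel) +
    (\<integral>\<^sup>+y. ennreal (norm (h (Complex (-r) y))) * indicator {-2..2} y \<partial>lborel)"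
proof -
  define k where "k z = h z / z" for z
  define a1 a2 a3 a4 where a: "a1 = Complex (-r) (-r)" "a2 = Complex r (-r)" "a3 = Complex r r" "a4 = Complex (-r) r"
  have ch: "continuous_on S h" for S
    using holomorphic_on_imp_continuous_on[OF h] continuous_on_subset by blast
  have [measurable]: "h \<in> borel_measurable borel"
    by (rule borel_measurable_continuous_onI) (rule ch)
  have km: "k \<in> borel_measurable borel"
    unfolding k_def by measurable
  have ck: "continuous_on S k" if "0 \<notin> S" for S
    unfolding k_def using that by (intro continuous_intros ch) auto
  have seg: "closed_segment p q \<subseteq> path_image (rectpath a1 a3)"
      if "(p, q) \<in> {(a1,a2),(a2,a3),(a3,a4),(a4,a1)}" for p q
    using that by (auto simp: rectpath_def Let_def path_image_join a)
  have nz: "0 \<notin> path_image (rectpath a1 a3)"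
    using r by (simp add: path_image_rectpath a)
  have seg0: "0 \<notin> closed_segment p q"
      if "(p, q) \<in> {(a1,a2),(a2,a3),(a3,a4),(a4,a1)}" for p q
    using seg[OF that] nz by blast
  have box: "0 \<in> box a1 a3"
    using r by (simp add: in_box_complex_iff a)
  have wn: "winding_number (rectpath a1 a3) 0 = 1"
    by (rule winding_number_rectpath[OF box])
  have "((\<lambda>w. h w / (w - 0)) has_contour_integral (2 * pi * \<i> * winding_number (rectpath a1 a3) 0 * h 0)) (rectpath a1 a3)"
    by (rule Cauchy_integral_formula_convex_simple[OF convex_UNIV h]) (use nz in auto)
  then have "contour_integral (rectpath a1 a3) k = 2 * pi * \<i> * h 0"
    unfolding k_def[abs_def] by (intro contour_integral_unique) (simp add: wn)
  moreover have "contour_integral (rectpath a1 a3) k = contour_integral (linepath a1 a2) k +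
      contour_integral (linepath a2 a3) k + contour_integral (linepath a3 a4) k + contour_integral (linepath a4 a1) k"
  proof -
    have ci: "k contour_integrable_on linepath p q"
        if "(p, q) \<in> {(a1,a2),(a2,a3),(a3,a4),(a4,a1)}" for p q
      by (intro contour_integrable_continuous_linepath ck seg0 that)
    have "rectpath a1 a3 = linepath a1 a2 +++ linepath a2 a3 +++ linepath a3 a4 +++ linepath a4 a1"
      by (simp add: rectpath_def Let_def a)
    then show ?thesis
      using ci by (simp add: contour_integrable_joinI)
  qed
  ultimately have "2 * pi * norm (h 0) = norm (contour_integral (linepath a1 a2) k +
      contour_integral (linepath a2 a3) k + contour_integral (linepath a3 a4) k + contour_integral (linepath a4 a1) k)"
    by (metis norm_mult norm_of_real norm_ii abs_of_nonneg pi_ge_zero mult.right_neutral norm_numeral of_real_mult of_real_numeral)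
  also have "\<dots> \<le> norm (contour_integral (linepath a1 a2) k) +
      norm (contour_integral (linepath a2 a3) k) + norm (contour_integral (linepath a3 a4) k) + norm (contour_integral (linepath a4 a1) k)"
    by (intro norm_triangle_le add_mono order_refl)
  finally have "ennreal (2 * pi * norm (h 0)) \<le> ennreal (norm (contour_integral (linepath a1 a2) k)) +
      ennreal (norm (contour_integral (linepath a2 a3) k)) + ennreal (norm (contour_integral (linepath a3 a4) k)) +
      ennreal (norm (contour_integral (linepath a4 a1) k))"
    by (simp flip: ennreal_plus add: ennreal_leI)
  also have "\<dots> \<le> (\<integral>\<^sup>+x. ennreal (norm (k (Complex x (-r)))) * indicator {min (-r) r..max (-r) r} x \<partial>lborel) +
    (\<integral>\<^sup>+y. ennreal (norm (k (Complex r y))) * indicator {min (-r) r..max (-r) r} y \<partial>lborel) +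
    (\<integral>\<^sup>+x. ennreal (norm (k (Complex x r))) * indicator {min r (-r)..max r (-r)} x \<partial>lborel) +
    (\<integral>\<^sup>+y. ennreal (norm (k (Complex (-r) y))) * indicator {min r (-r)..max r (-r)} y \<partial>lborel)"
    unfolding a
    by (intro add_mono norm_contour_integral_horizontal_le norm_contour_integral_vertical_le km ck seg0[unfolded a])
       (use r in auto)
  also have "\<dots> \<le> (\<integral>\<^sup>+x. ennreal (norm (h (Complex x (-r)))) * indicator {-2..2} x \<partial>lborel) +
    (\<integral>\<^sup>+y. ennreal (norm (h (Complex r y))) * indicator {-2..2} y \<partial>lborel) +
    (\<integral>\<^sup>+x. ennreal (norm (h (Complex x r))) * indicator {-2..2} x \<partial>lborel) +
    (\<integral>\<^sup>+y. ennreal (norm (h (Complex (-r) y))) * indicator {-2..2} y \<partial>lborel)"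
  proof -
    have "1 \<le> norm (Complex x y)" if "\<bar>x\<bar> = r \<or> \<bar>y\<bar> = r" for x y
      using that r abs_Re_le_cmod[of "Complex x y"] abs_Im_le_cmod[of "Complex x y"] by auto
    then have le: "norm (k (Complex x y)) \<le> norm (h (Complex x y))" if "\<bar>x\<bar> = r \<or> \<bar>y\<bar> = r" for x y
      using that unfolding k_def norm_divide by (auto simp: divide_le_eq intro: mult_left_le_one_le order_trans[OF _ mult_left_mono[of 1]])
    show ?thesis
      using r by (intro add_mono nn_integral_mono mult_mono ennreal_leI le) (auto simp: indicator_def)
  qed
  finally show ?thesis .
qed

section \<open>Area mean value estimates for entire functions\<close>

lemma cball_in_sets_borel [measurable]: "cball a r \<in> sets borel"
  by (rule borel_closed) simp

lemma entire_measurable: "h holomorphic_on UNIV \<Longrightarrow> h \<in> borel_measurable borel"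
  by (intro borel_measurable_continuous_onI holomorphic_on_imp_continuous_on)

text \<open>Integrate the previous estimate over \<open>r\<close> in \<open>[1, 2]\<close>: each of the four sides sweeps out a part of the
  square of half-width \<open>2\<close>, which lies in the disc of radius \<open>3\<close>. This gives \<open>2 * pi * |h 0| \<le> 4 * I\<close>
  for the area integral \<open>I\<close>.\<close>

lemma norm_0_le_area_integral:
  assumes h: "h holomorphic_on UNIV"
  shows "ennreal (norm (h 0)) \<le> (\<integral>\<^sup>+z. ennreal (norm (h z)) * indicator (cball 0 3) z \<partial>lborel)"
proof -
  have [measurable]: "h \<in> borel_measurable borel"
    by (rule entire_measurable[OF h])
  define g where "g z = ennreal (norm (h z)) * indicator (cball 0 3) z" for z :: complex
  define I where "I = (\<integral>\<^sup>+z. g z \<partial>lborel)"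
  have gm[measurable]: "g \<in> borel_measurable borel"
    unfolding g_def by measurable
  have gm2[measurable]: "(\<lambda>(x,y). g (Complex x y)) \<in> borel_measurable (lborel \<Otimes>\<^sub>M lborel)"
    "(\<lambda>(y,x). g (Complex x y)) \<in> borel_measurable (lborel \<Otimes>\<^sub>M lborel)"
    unfolding Complex_eq by measurable
  define X where "X y = (\<integral>\<^sup>+x. g (Complex x y) \<partial>lborel)" for y
  define Y where "Y x = (\<integral>\<^sup>+y. g (Complex x y) \<partial>lborel)" for x
  have Xm[measurable]: "X \<in> borel_measurable borel"
    using lborel.borel_measurable_nn_integral[OF gm2(2)] unfolding X_def by simp
  have Ym[measurable]: "Y \<in> borel_measurable borel"
    using lborel.borel_measurable_nn_integral[OF gm2(1)] unfolding Y_def by simp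
  have IX: "(\<integral>\<^sup>+y. X y \<partial>lborel) = I" "(\<integral>\<^sup>+y. X (-y) \<partial>lborel) = I"
    using nn_integral_real_affine[of X "-1" 0] unfolding I_def X_def nn_integral_lborel_complex'[OF gm] by auto
  have IY: "(\<integral>\<^sup>+x. Y x \<partial>lborel) = I" "(\<integral>\<^sup>+x. Y (-x) \<partial>lborel) = I"
    using nn_integral_real_affine[of Y "-1" 0] unfolding I_def Y_def nn_integral_lborel_complex[OF gm] by auto
  have in3: "Complex x y \<in> cball 0 3" if "\<bar>x\<bar> \<le> 2" "\<bar>y\<bar> \<le> 2" for x y
  proof -
    have "x\<^sup>2 + y\<^sup>2 \<le> 3\<^sup>2"
      using power_mono[OF that(1), of 2] power_mono[OF that(2), of 2] by simp
    then show ?thesis by (simp add: cmod_def real_sqrt_le_iff real_le_lsqrt)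
  qed
  have ind: "ennreal (norm (h (Complex x y))) * indicator {-2..2} x \<le> g (Complex x y)" if "\<bar>y\<bar> \<le> 2" for x y
    using in3[OF _ that] unfolding g_def by (auto simp: indicator_def)
  have ind': "ennreal (norm (h (Complex x y))) * indicator {-2..2} y \<le> g (Complex x y)" if "\<bar>x\<bar> \<le> 2" for x y
    using in3[OF that] unfolding g_def by (auto simp: indicator_def)
  have "ennreal (2 * pi * norm (h 0)) * indicator {1..2} r \<le> X (-r) + Y r + X r + Y (-r)" for r :: real
  proof (cases "r \<in> {1..2}")
    case True
    then have "ennreal (2 * pi * norm (h 0)) \<le>
      (\<integral>\<^sup>+x. ennreal (norm (h (Complex x (-r)))) * indicator {-2..2} x \<partial>lborel) +
      (\<integral>\<^sup>+y. ennreal (norm (h (Complex r y))) * indicator {-2..2} y \<partial>lborel) +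
      (\<integral>\<^sup>+x. ennreal (norm (h (Complex x r))) * indicator {-2..2} x \<partial>lborel) +
      (\<integral>\<^sup>+y. ennreal (norm (h (Complex (-r) y))) * indicator {-2..2} y \<partial>lborel)"
      by (intro norm_at_0_le_square_integrals h) auto
    also have "\<dots> \<le> X (-r) + Y r + X r + Y (-r)"
      unfolding X_def Y_def using True by (intro add_mono nn_integral_mono ind ind') auto
    finally show ?thesis using True by simp
  qed simp
  then have "(\<integral>\<^sup>+r. ennreal (2 * pi * norm (h 0)) * indicator {1..2::real} r \<partial>lborel) \<le>
      (\<integral>\<^sup>+r. X (-r) + Y r + X r + Y (-r) \<partial>lborel)"
    by (intro nn_integral_mono)
  also have "\<dots> = I + I + I + I"
    by (simp add: nn_integral_add IX IY)
  also have "\<dots> = ennreal 4 * I"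
  proof -
    have "ennreal 4 = 1 + 1 + 1 + 1"
      by simp
    then show ?thesis
      by (simp only: distrib_right mult_1)
  qed
  also have "(\<integral>\<^sup>+r. ennreal (2 * pi * norm (h 0)) * indicator {1..2::real} r \<partial>lborel) = ennreal (2 * pi * norm (h 0))"
    by (subst nn_integral_cmult) auto
  finally have le: "ennreal (2 * pi * norm (h 0)) \<le> ennreal 4 * I" .
  have "ennreal 4 * ennreal (norm (h 0)) = ennreal (4 * norm (h 0))"
    by (simp add: ennreal_mult)
  also have "\<dots> \<le> ennreal (2 * pi * norm (h 0))"
    using pi_ge_two by (intro ennreal_leI mult_right_mono) auto
  also note le
  finally show ?thesis
    by (subst (asm) ennreal_mult_le_mult_iff) (auto simp: I_def g_def)
qed

text \<open>Translation and the Cauchy-Schwarz inequality; the constant \<open>36\<close> is the area of a square of half-width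
  \<open>3\<close> that contains the disc.\<close>

lemma norm_sq_le_area_integral:
  assumes h: "h holomorphic_on UNIV"
  shows "ennreal ((norm (h a))\<^sup>2) \<le> 36 * (\<integral>\<^sup>+z. ennreal ((norm (h z))\<^sup>2) * indicator (cball a 3) z \<partial>lborel)"
proof -
  have [measurable]: "h \<in> borel_measurable borel"
    by (rule entire_measurable[OF h])
  have "emeasure lborel (cball a 3) \<le> emeasure lborel (cbox (a - Complex 3 3) (a + Complex 3 3))"
  proof (rule emeasure_mono)
    show "cball a 3 \<subseteq> cbox (a - Complex 3 3) (a + Complex 3 3)"
    proof
      fix z assume "z \<in> cball a 3"
      then have "\<bar>Re (a - z)\<bar> \<le> 3" "\<bar>Im (a - z)\<bar> \<le> 3"
        using abs_Re_le_cmod[of "a - z"] abs_Im_le_cmod[of "a - z"] by (auto simp: dist_norm)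
      then show "z \<in> cbox (a - Complex 3 3) (a + Complex 3 3)"
        by (auto simp: in_cbox_complex_iff)
    qed
  qed simp
  also have "\<dots> = 36"
    by (subst emeasure_lborel_cbox) (auto simp: Basis_complex_def)
  finally have vol: "emeasure lborel (cball a 3) \<le> 36" .
  have ind: "indicator (cball 0 3) z = (indicator (cball a 3) (a + z) :: ennreal)" for z
    by (simp add: indicator_def dist_norm)
  have "(\<lambda>z. h (a + z)) holomorphic_on UNIV"
    by (rule holomorphic_on_compose_gen[OF _ h, unfolded o_def]) (auto intro!: holomorphic_intros)
  from norm_0_le_area_integral[OF this]
  have "ennreal (norm (h a)) \<le> (\<integral>\<^sup>+z. ennreal (norm (h (a + z))) * indicator (cball a 3) (a + z) \<partial>lborel)"
    by (simp add: ind)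
  also have "\<dots> = (\<integral>\<^sup>+z. ennreal (norm (h z)) * indicator (cball a 3) z \<partial>lborel)"
    by (rule nn_integral_lborel_translate[of "\<lambda>z. ennreal (norm (h z)) * indicator (cball a 3) z"]) measurable
  also have "\<dots> = (\<integral>\<^sup>+z. (ennreal (norm (h z)) * indicator (cball a 3) z) * indicator (cball a 3) z \<partial>lborel)"
    by (intro nn_integral_cong) (auto simp: indicator_def)
  finally have "(ennreal (norm (h a)))\<^sup>2 \<le>
      (\<integral>\<^sup>+z. (ennreal (norm (h z)) * indicator (cball a 3) z) * indicator (cball a 3) z \<partial>lborel)\<^sup>2"
    by (rule power_mono_ennreal)
  also have "\<dots> \<le> (\<integral>\<^sup>+z. (ennreal (norm (h z)) * indicator (cball a 3) z)\<^sup>2 \<partial>lborel) *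
      (\<integral>\<^sup>+z. (indicator (cball a 3) z)\<^sup>2 \<partial>lborel)"
    by (rule Cauchy_Schwarz_nn_integral) measurable
  also have "(\<integral>\<^sup>+z. (ennreal (norm (h z)) * indicator (cball a 3) z)\<^sup>2 \<partial>lborel) =
      (\<integral>\<^sup>+z. ennreal ((norm (h z))\<^sup>2) * indicator (cball a 3) z \<partial>lborel)"
    by (intro nn_integral_cong) (auto simp: indicator_def ennreal_power)
  also have "(\<integral>\<^sup>+z. (indicator (cball a 3) z)\<^sup>2 \<partial>lborel) = emeasure lborel (cball a 3)"
  proof -
    have "(\<integral>\<^sup>+z. (indicator (cball a 3) z :: ennreal)\<^sup>2 \<partial>lborel) = (\<integral>\<^sup>+z. indicator (cball a 3) z \<partial>lborel)"
      by (intro nn_integral_cong) (simp add: indicator_def)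
    then show ?thesis by simp
  qed
  finally have "ennreal ((norm (h a))\<^sup>2) \<le>
      (\<integral>\<^sup>+z. ennreal ((norm (h z))\<^sup>2) * indicator (cball a 3) z \<partial>lborel) * emeasure lborel (cball a 3)"
    by (simp add: ennreal_power)
  also have "\<dots> \<le> (\<integral>\<^sup>+z. ennreal ((norm (h z))\<^sup>2) * indicator (cball a 3) z \<partial>lborel) * 36"
    by (intro mult_left_mono vol) simp
  finally show ?thesis
    by (simp only: mult.commute)
qed

text \<open>The mean value estimate at the points of the unit disc bounds \<open>h\<close> there by \<open>6 * sqrt I\<close>, and Cauchy's
  inequality turns this into a bound for the derivative on the disc of radius \<open>1 / 2\<close>.\<close>

lemma local_Lipschitz_area_bound:
  assumes h: "h holomorphic_on UNIV" and c: "norm c \<le> 1/2"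
  shows "ennreal ((norm (h c - h 0))\<^sup>2) \<le>
    ennreal (144 * (norm c)\<^sup>2) * (\<integral>\<^sup>+z. ennreal ((norm (h z))\<^sup>2) * indicator (cball 0 4) z \<partial>lborel)"
proof -
  define I where "I = (\<integral>\<^sup>+z. ennreal ((norm (h z))\<^sup>2) * indicator (cball 0 4) z \<partial>lborel)"
  have le: "ennreal ((norm (h u))\<^sup>2) \<le> 36 * I" if "norm u \<le> 1" for u
  proof -
    have "cball u 3 \<subseteq> cball 0 4"
      using that by (auto simp: subset_iff dist_norm) (smt (verit) norm_triangle_sub norm_minus_commute)
    then have "(indicator (cball u 3) z :: ennreal) \<le> indicator (cball 0 4) z" for z
      by (auto simp: indicator_def)
    then have "(\<integral>\<^sup>+z. ennreal ((norm (h z))\<^sup>2) * indicator (cball u 3) z \<partial>lborel) \<le> I"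
      unfolding I_def by (intro nn_integral_mono mult_left_mono) auto
    then show ?thesis
      using norm_sq_le_area_integral[OF h, of u] by (meson mult_left_mono order_trans zero_le)
  qed
  \<comment> \<open>The product \<open>0 * \<infinity>\<close> is \<open>0\<close>, so that \<open>c = 0\<close> has to be separated.\<close>
  consider "c = 0" | "I = \<infinity>" "c \<noteq> 0" | J where "I = ennreal J" "J \<ge> 0"
    by (metis ennreal_cases infinity_ennreal_def)
  then show ?thesis
  proof cases
    case 1
    then show ?thesis by simp
  next
    case 2
    then show ?thesis unfolding I_def[symmetric] by (simp add: ennreal_mult_eq_top_iff)
  next
    case 3
    define M where "M = 6 * sqrt J"
    have M: "norm (h u) \<le> M" if "norm u \<le> 1" for u
    proof -
      have "ennreal ((norm (h u))\<^sup>2) \<le> ennreal (36 * J)"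
        using le[OF that] 3 by (simp add: ennreal_mult)
      then have "(norm (h u))\<^sup>2 \<le> M\<^sup>2"
        using 3 by (simp add: M_def power_mult_distrib)
      then show ?thesis
        using 3 by (auto simp: M_def intro: power2_le_imp_le)
    qed
    have "norm (deriv h u) \<le> 2 * M" if "u \<in> cball 0 (1/2)" for u
    proof -
      have "norm ((deriv ^^ 1) h u) \<le> fact 1 * M / (1/2) ^ 1"
      proof (rule Cauchy_inequality)
        show "h holomorphic_on ball u (1/2)"
          using h holomorphic_on_subset by blast
        show "continuous_on (cball u (1/2)) h"
          using h holomorphic_on_subset holomorphic_on_imp_continuous_on by blast
        fix x assume "norm (u - x) = 1/2"
        then have "norm x \<le> 1"
          using that norm_triangle_sub[of x u] by (simp add: norm_minus_commute)
        then show "norm (h x) \<le> M" by (rule M)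
      qed simp
      then show ?thesis by simp
    qed
    then have "norm (h c - h 0) \<le> 2 * M * norm (c - 0)"
      using c h by (intro field_differentiable_bound[of "cball 0 (1/2)" h "deriv h"])
        (auto intro: holomorphic_derivI has_field_derivative_at_within)
    then have "(norm (h c - h 0))\<^sup>2 \<le> (2 * M * norm c)\<^sup>2"
      by (intro power_mono) auto
    also have "\<dots> = 144 * (norm c)\<^sup>2 * J"
      using 3 by (simp add: M_def power_mult_distrib)
    finally show ?thesis
      unfolding I_def[symmetric] using 3 by (simp flip: ennreal_mult)
  qed
qed

section \<open>The Fock norm, Weyl shifts and sampling inequalities\<close>

definition fock_density :: "(complex \<Rightarrow> complex) \<Rightarrow> complex \<Rightarrow> ennreal" where
  "fock_density F z = ennreal ((norm (F z))\<^sup>2 * exp (- pi * (norm z)\<^sup>2))"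

text \<open>The squared norm of the Fock space with parameter \<open>pi\<close>, as an extended real, so that membership in
  the space is finiteness of the energy.\<close>

definition fock_energy :: "(complex \<Rightarrow> complex) \<Rightarrow> ennreal" where
  "fock_energy F = (\<integral>\<^sup>+z. fock_density F z \<partial>lborel)"

lemma fock_density_measurable [measurable]:
  assumes [measurable]: "F \<in> borel_measurable borel"
  shows "fock_density F \<in> borel_measurable borel"
  unfolding fock_density_def[abs_def] by measurable

lemma fock_space_iff:
  "F \<in> fock_space pi \<longleftrightarrow> F holomorphic_on UNIV \<and> fock_energy F < \<infinity>"
proof (cases "F holomorphic_on UNIV")
  case True
  then have [measurable]: "F \<in> borel_measurable borel"
    by (rule entire_measurable)
  have "integrable lebesgue (\<lambda>z. (norm (F z))\<^sup>2 * exp (- pi * (norm z)\<^sup>2)) \<longleftrightarrow>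
      integrable lborel (\<lambda>z. (norm (F z))\<^sup>2 * exp (- pi * (norm z)\<^sup>2))"
    by (rule integrable_completion) measurable
  also have "\<dots> \<longleftrightarrow> fock_energy F < \<infinity>"
    unfolding fock_energy_def fock_density_def by (simp add: integrable_iff_bounded abs_mult)
  finally show ?thesis using True by (simp add: fock_space_def)
qed (simp add: fock_space_def)

lemma fock_norm_sq:
  assumes "F \<in> fock_space pi"
  shows "ennreal ((fock_norm pi F)\<^sup>2) = fock_energy F"
proof -
  have [measurable]: "F \<in> borel_measurable borel"
    using assms by (auto simp: fock_space_iff entire_measurable)
  let ?g = "\<lambda>z. (norm (F z))\<^sup>2 * exp (- pi * (norm z)\<^sup>2)"
  have i: "integrable lborel ?g"
    using assms integrable_completion[of ?g lborel] by (simp add: fock_space_def)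
  have "(fock_norm pi F)\<^sup>2 = (LINT z|lborel. ?g z)"
    unfolding fock_norm_def by (subst integral_completion) auto
  then show ?thesis
    unfolding fock_energy_def fock_density_def by (subst nn_integral_eq_integral[OF i]) auto
qed

lemma fock_energy_add_le:
  assumes [measurable]: "F \<in> borel_measurable borel" "G \<in> borel_measurable borel"
  shows "fock_energy (\<lambda>z. F z + G z) \<le> 2 * fock_energy F + 2 * fock_energy G"
proof -
  have "fock_density (\<lambda>z. F z + G z) z \<le> 2 * fock_density F z + 2 * fock_density G z" for z
  proof -
    have "(norm (F z + G z))\<^sup>2 \<le> (norm (F z) + norm (G z))\<^sup>2"
      by (intro power_mono norm_triangle_ineq) auto
    also have "\<dots> \<le> 2 * (norm (F z))\<^sup>2 + 2 * (norm (G z))\<^sup>2"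
      using sum_squares_bound[of "norm (F z)" "norm (G z)"] by (simp add: power2_sum)
    finally have "(norm (F z + G z))\<^sup>2 * exp (- pi * (norm z)\<^sup>2) \<le>
        2 * ((norm (F z))\<^sup>2 * exp (- pi * (norm z)\<^sup>2)) + 2 * ((norm (G z))\<^sup>2 * exp (- pi * (norm z)\<^sup>2))"
      by (simp add: distrib_right[symmetric] mult.assoc[symmetric])
    then have "ennreal ((norm (F z + G z))\<^sup>2 * exp (- pi * (norm z)\<^sup>2)) \<le>
        ennreal (2 * ((norm (F z))\<^sup>2 * exp (- pi * (norm z)\<^sup>2)) + 2 * ((norm (G z))\<^sup>2 * exp (- pi * (norm z)\<^sup>2)))"
      by (rule ennreal_leI)
    then show ?thesis
      unfolding fock_density_def by (simp add: ennreal_plus ennreal_mult)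
  qed
  then have "fock_energy (\<lambda>z. F z + G z) \<le> (\<integral>\<^sup>+z. 2 * fock_density F z + 2 * fock_density G z \<partial>lborel)"
    unfolding fock_energy_def by (rule nn_integral_mono)
  also have "\<dots> = 2 * fock_energy F + 2 * fock_energy G"
    unfolding fock_energy_def by (subst nn_integral_add) (auto simp: nn_integral_cmult)
  finally show ?thesis .
qed

lemma fock_energy_cmult:
  assumes [measurable]: "F \<in> borel_measurable borel"
  shows "fock_energy (\<lambda>z. c * F z) = ennreal ((norm c)\<^sup>2) * fock_energy F"
  unfolding fock_energy_def fock_density_def
  by (subst nn_integral_cmult[symmetric]) (auto simp: norm_mult power_mult_distrib ennreal_mult mult.assoc)

text \<open>The projective representation of translations on the Fock space; the shifts of the constant \<open>1\<close> are
  the normalised reproducing kernels.\<close>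

definition weyl_shift :: "complex \<Rightarrow> (complex \<Rightarrow> complex) \<Rightarrow> complex \<Rightarrow> complex" where
  "weyl_shift c F z = exp (of_real pi * cnj c * z - of_real (pi / 2 * (norm c)\<^sup>2)) * F (z - c)"

lemma norm_diff_sq: "(norm (z - c :: complex))\<^sup>2 = (norm z)\<^sup>2 - 2 * Re (cnj c * z) + (norm c)\<^sup>2"
  by (simp add: cmod_power2 power2_diff algebra_simps)

text \<open>The exponential factor is chosen so that the weighted modulus of \<open>F\<close> is merely translated.\<close>

lemma fock_density_weyl_shift: "fock_density (weyl_shift c F) z = fock_density F (z - c)"
proof -
  have e: "exp (2 * (pi * Re (cnj c * z) - pi / 2 * (norm c)\<^sup>2)) * exp (- pi * (norm z)\<^sup>2) = exp (- pi * (norm (z - c))\<^sup>2)"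
    unfolding norm_diff_sq exp_add[symmetric] by (simp add: algebra_simps)
  have "Re (of_real pi * cnj c * z - of_real (pi / 2 * (norm c)\<^sup>2)) = pi * Re (cnj c * z) - pi / 2 * (norm c)\<^sup>2"
    by (simp add: algebra_simps)
  then have "(norm (weyl_shift c F z))\<^sup>2 = exp (2 * (pi * Re (cnj c * z) - pi / 2 * (norm c)\<^sup>2)) * (norm (F (z - c)))\<^sup>2"
    by (simp only: weyl_shift_def norm_mult norm_exp_eq_Re power_mult_distrib exp_double)
  then show ?thesis
    unfolding fock_density_def e[symmetric] by (simp only: mult_ac)
qed

lemma weyl_shift_holomorphic [holomorphic_intros]:
  assumes "F holomorphic_on UNIV"
  shows "weyl_shift c F holomorphic_on UNIV"
proof -
  have "(\<lambda>z. F (z - c)) holomorphic_on UNIV"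
    by (rule holomorphic_on_compose_gen[OF _ assms, unfolded o_def]) (auto intro!: holomorphic_intros)
  then show ?thesis
    unfolding weyl_shift_def[abs_def] by (intro holomorphic_intros)
qed

lemma fock_energy_weyl_shift:
  assumes [measurable]: "F \<in> borel_measurable borel"
  shows "fock_energy (weyl_shift c F) = fock_energy F"
  unfolding fock_energy_def fock_density_weyl_shift
  using nn_integral_lborel_translate[of "fock_density F" "- c"] by simp

lemma nn_integral_gaussian_finite:
  assumes "a > 0"
  shows "(\<integral>\<^sup>+x. ennreal (exp (- a * x\<^sup>2)) \<partial>(lborel :: real measure)) < \<infinity>"
proof -
  define s where "s = sqrt (1 / (2 * a))"
  have s: "s > 0" "2 * s\<^sup>2 = 1 / a"
    using assms by (simp_all add: s_def)
  have "exp (- a * x\<^sup>2) = sqrt (2 * pi * s\<^sup>2) * normal_density 0 s x" for x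
    using s assms by (simp add: normal_density_def)
  moreover have "integrable lborel (\<lambda>x. sqrt (2 * pi * s\<^sup>2) * normal_density 0 s x)"
    using s by auto
  ultimately have "integrable lborel (\<lambda>x. exp (- a * x\<^sup>2))"
    by simp
  then show ?thesis
    by (simp add: integrable_iff_bounded)
qed

lemma nn_integral_gaussian_complex_finite:
  assumes "a > 0"
  shows "(\<integral>\<^sup>+z. ennreal (exp (- a * (norm z)\<^sup>2)) \<partial>(lborel :: complex measure)) < \<infinity>"
proof -
  have "(\<integral>\<^sup>+z. ennreal (exp (- a * (norm z)\<^sup>2)) \<partial>(lborel :: complex measure)) =
      (\<integral>\<^sup>+x. \<integral>\<^sup>+y. ennreal (exp (- a * x\<^sup>2)) * ennreal (exp (- a * y\<^sup>2)) \<partial>lborel \<partial>lborel)"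
    by (subst nn_integral_lborel_complex)
      (auto simp: cmod_power2 distrib_left ennreal_mult[symmetric] exp_add[symmetric])
  also have "\<dots> = (\<integral>\<^sup>+x. ennreal (exp (- a * x\<^sup>2)) \<partial>lborel) * (\<integral>\<^sup>+x. ennreal (exp (- a * x\<^sup>2)) \<partial>lborel)"
    by (simp add: nn_integral_cmult nn_integral_multc)
  also have "\<dots> < \<infinity>"
    using nn_integral_gaussian_finite[OF assms] by (simp add: ennreal_mult_less_top)
  finally show ?thesis .
qed

lemma fock_energy_one_finite: "fock_energy (\<lambda>_. 1) < \<infinity>"
  using nn_integral_gaussian_complex_finite[of pi] by (simp add: fock_energy_def fock_density_def)

text \<open>The two sampling inequalities with partial sums in place of infinite ones: an upper bound for all
  finite partial sums controls the norm, and every finite partial sum is controlled by the norm.\<close>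

locale fock_sampling =
  fixes \<Lambda> :: "complex set" and A B :: real
  assumes A_pos: "A > 0" and B_pos: "B > 0"
    and lower: "\<And>F D. \<lbrakk>F holomorphic_on UNIV; fock_energy F < \<infinity>;
        \<And>X. finite X \<Longrightarrow> X \<subseteq> \<Lambda> \<Longrightarrow> (\<Sum>l\<in>X. fock_density F l) \<le> D\<rbrakk> \<Longrightarrow> ennreal A * fock_energy F \<le> D"
    and upper: "\<And>F X. \<lbrakk>F holomorphic_on UNIV; fock_energy F < \<infinity>; finite X; X \<subseteq> \<Lambda>\<rbrakk>
        \<Longrightarrow> (\<Sum>l\<in>X. fock_density F l) \<le> ennreal B * fock_energy F"

lemma stable_sampling_imp_fock_sampling:
  assumes "stable_sampling pi \<Lambda>"
  obtains A B where "fock_sampling \<Lambda> A B"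
proof -
  let ?d = "\<lambda>F \<gamma>. exp (- pi * (norm \<gamma>)\<^sup>2) * (norm (F \<gamma> :: complex))\<^sup>2"
  obtain A B where AB: "A > 0" "B > 0" and s: "\<And>F. F \<in> fock_space pi \<Longrightarrow> ?d F summable_on \<Lambda>"
    "\<And>F. F \<in> fock_space pi \<Longrightarrow> A * (fock_norm pi F)\<^sup>2 \<le> infsum (?d F) \<Lambda>"
    "\<And>F. F \<in> fock_space pi \<Longrightarrow> infsum (?d F) \<Lambda> \<le> B * (fock_norm pi F)\<^sup>2"
    using assms unfolding stable_sampling_def by blast
  have dens: "fock_density F \<gamma> = ennreal (?d F \<gamma>)" for F \<gamma>
    by (simp add: fock_density_def mult.commute)
  have sum: "(\<Sum>l\<in>X. fock_density F l) = ennreal (\<Sum>l\<in>X. ?d F l)" for X F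
    unfolding dens by (rule sum_ennreal) auto
  have "fock_sampling \<Lambda> A B"
  proof
    fix F D assume F: "F holomorphic_on UNIV" "fock_energy F < \<infinity>"
      and D: "\<And>X. finite X \<Longrightarrow> X \<subseteq> \<Lambda> \<Longrightarrow> (\<Sum>l\<in>X. fock_density F l) \<le> D"
    have F': "F \<in> fock_space pi"
      using F by (simp add: fock_space_iff)
    show "ennreal A * fock_energy F \<le> D"
    proof (cases D)
      case (real d)
      have "infsum (?d F) \<Lambda> \<le> d"
        using D s(1)[OF F'] real by (intro infsum_le_finite_sums) (auto simp: sum)
      with s(2)[OF F'] have "A * (fock_norm pi F)\<^sup>2 \<le> d" by simp
      then have "ennreal (A * (fock_norm pi F)\<^sup>2) \<le> ennreal d" by (rule ennreal_leI)
      then show ?thesis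
        using AB real by (simp add: ennreal_mult fock_norm_sq[OF F'])
    qed simp
  next
    fix F X assume F: "F holomorphic_on UNIV" "fock_energy F < \<infinity>" and X: "finite X" "X \<subseteq> \<Lambda>"
    have F': "F \<in> fock_space pi"
      using F by (simp add: fock_space_iff)
    have "(\<Sum>l\<in>X. ?d F l) \<le> infsum (?d F) \<Lambda>"
      using X s(1)[OF F'] by (intro finite_sum_le_infsum) auto
    also note s(3)[OF F']
    finally have "ennreal (\<Sum>l\<in>X. ?d F l) \<le> ennreal (B * (fock_norm pi F)\<^sup>2)"
      by (rule ennreal_leI)
    then show "(\<Sum>l\<in>X. fock_density F l) \<le> ennreal B * fock_energy F"
      using AB by (simp add: sum ennreal_mult fock_norm_sq[OF F'])
  qed (use AB in auto)
  then show thesis by (rule that)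
qed

text \<open>On the left half-plane the derivative of \<open>exp\<close> has modulus at most \<open>1\<close>.\<close>

lemma norm_exp_minus_1_le:
  fixes s :: complex
  assumes "Re s \<le> 0"
  shows "norm (exp s - 1) \<le> norm s"
proof -
  have "norm (exp s - exp 0) \<le> 1 * norm (s - 0)"
    using assms
    by (intro field_differentiable_bound[of "{z. Re z \<le> 0}" exp exp])
      (auto intro: DERIV_exp has_field_derivative_at_within convex_halfspace_Re_le)
  then show ?thesis by simp
qed

context fock_sampling begin

text \<open>The discs of radius \<open>4\<close> around the sampling points overlap a bounded number of times. Indeed the
  indicator of such a disc at \<open>z\<close> is at most \<open>exp (16 * pi)\<close> times the density at its centre of the
  reproducing kernel of \<open>z\<close>, and these densities sum to at most \<open>B\<close> times the energy of the kernel,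
  which does not depend on \<open>z\<close>.\<close>

lemma sum_ball_integrals_le:
  assumes [measurable]: "g \<in> borel_measurable borel" and X: "finite X" "X \<subseteq> \<Lambda>"
  shows "(\<Sum>l\<in>X. \<integral>\<^sup>+z. g z * indicator (cball l 4) z \<partial>lborel) \<le>
    ennreal (exp (16 * pi) * B) * fock_energy (\<lambda>_. 1) * (\<integral>\<^sup>+z. g z \<partial>lborel)"
proof -
  have *: "(\<Sum>l\<in>X. indicator (cball l 4) z) \<le> ennreal (exp (16 * pi) * B) * fock_energy (\<lambda>_. 1)" for z
  proof -
    have "indicator (cball l 4) z \<le> ennreal (exp (16 * pi)) * fock_density (weyl_shift z (\<lambda>_. 1)) l" for l
    proof (cases "z \<in> cball l 4")
      case True
      then have "(norm (l - z))\<^sup>2 \<le> 4\<^sup>2"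
        by (intro power_mono) (auto simp: dist_norm)
      then have "1 \<le> exp (16 * pi + - pi * (norm (l - z))\<^sup>2)"
        by (simp add: mult.commute)
      then have "ennreal 1 \<le> ennreal (exp (16 * pi) * exp (- pi * (norm (l - z))\<^sup>2))"
        unfolding exp_add by (rule ennreal_leI)
      moreover have "fock_density (weyl_shift z (\<lambda>_. 1)) l = ennreal (exp (- pi * (norm (l - z))\<^sup>2))"
        by (subst fock_density_weyl_shift) (simp add: fock_density_def)
      ultimately show ?thesis using True
        by (simp add: ennreal_mult)
    qed simp
    then have "(\<Sum>l\<in>X. indicator (cball l 4) z) \<le> (\<Sum>l\<in>X. ennreal (exp (16 * pi)) * fock_density (weyl_shift z (\<lambda>_. 1)) l)"
      by (rule sum_mono)
    also have "\<dots> = ennreal (exp (16 * pi)) * (\<Sum>l\<in>X. fock_density (weyl_shift z (\<lambda>_. 1)) l)"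
      by (rule sum_distrib_left[symmetric])
    also have "\<dots> \<le> ennreal (exp (16 * pi)) * (ennreal B * fock_energy (weyl_shift z (\<lambda>_. 1)))"
      using fock_energy_one_finite
      by (intro mult_left_mono upper X weyl_shift_holomorphic) (auto simp: fock_energy_weyl_shift)
    finally show ?thesis
      using B_pos by (simp add: fock_energy_weyl_shift ennreal_mult mult.assoc)
  qed
  have "(\<Sum>l\<in>X. \<integral>\<^sup>+z. g z * indicator (cball l 4) z \<partial>lborel) = (\<integral>\<^sup>+z. (\<Sum>l\<in>X. g z * indicator (cball l 4) z) \<partial>lborel)"
    by (rule nn_integral_sum[symmetric]) measurable
  also have "\<dots> = (\<integral>\<^sup>+z. g z * (\<Sum>l\<in>X. indicator (cball l 4) z) \<partial>lborel)"
    by (simp add: sum_distrib_left)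
  also have "\<dots> \<le> (\<integral>\<^sup>+z. g z * (ennreal (exp (16 * pi) * B) * fock_energy (\<lambda>_. 1)) \<partial>lborel)"
    by (intro nn_integral_mono mult_left_mono *) auto
  also have "\<dots> = ennreal (exp (16 * pi) * B) * fock_energy (\<lambda>_. 1) * (\<integral>\<^sup>+z. g z \<partial>lborel)"
    by (subst nn_integral_multc) (auto simp: mult.commute)
  finally show ?thesis .
qed

end

section \<open>Multiplication by the variable preserves the Fock space\<close>

text \<open>Put \<open>h u = F (l + u) * exp (- pi * cnj l * u)\<close>. Then \<open>F l = h 0\<close>, and \<open>weyl_shift c F l\<close> is
  \<open>exp s * h (- c)\<close> where \<open>s\<close> has a nonpositive real part and modulus \<open>O(|c| * (1 + |l|))\<close>. The difference
  \<open>h (- c) - h 0\<close> is \<open>O(|c|)\<close> by the local Lipschitz bound; the Gaussian weight at \<open>l\<close> and the exponential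
  in \<open>h\<close> combine to the Gaussian weight at \<open>l + u\<close>, up to a factor bounded for \<open>|u| \<le> 4\<close>. The factor
  \<open>exp s - 1\<close> is what produces the weight \<open>|l|\<^sup>2\<close>.\<close>

lemma fock_density_weyl_shift_diff_le:
  assumes F: "F holomorphic_on UNIV" and c: "norm c \<le> 1/2"
  shows "fock_density (\<lambda>z. weyl_shift c F z - F z) l \<le> ennreal ((norm c)\<^sup>2) *
    (ennreal (288 * exp (16 * pi)) * (\<integral>\<^sup>+z. fock_density F z * indicator (cball l 4) z \<partial>lborel)
      + ennreal (16 * pi\<^sup>2) * (ennreal ((norm l)\<^sup>2) * fock_density F l) + ennreal (4 * pi\<^sup>2) * fock_density F l)"
proof -
  have [measurable]: "F \<in> borel_measurable borel"
    by (rule entire_measurable[OF F])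
  define h where "h u = F (l + u) * exp (- (of_real pi * cnj l * u))" for u
  define s where "s = of_real pi * (cnj c * l) - of_real pi * (cnj l * c) - of_real (pi / 2 * (norm c)\<^sup>2)"
  define w where "w = exp (- pi * (norm l)\<^sup>2)"
  have w0: "w \<ge> 0" by (simp add: w_def)
  have "(\<lambda>u. F (l + u)) holomorphic_on UNIV"
    by (rule holomorphic_on_compose_gen[OF _ F, unfolded o_def]) (auto intro!: holomorphic_intros)
  then have h: "h holomorphic_on UNIV"
    unfolding h_def[abs_def] by (intro holomorphic_intros)
  have h0: "h 0 = F l" by (simp add: h_def)
  have "weyl_shift c F l = exp s * h (- c)"
    by (simp add: weyl_shift_def s_def h_def exp_add[symmetric] algebra_simps)
  then have eq: "weyl_shift c F l - F l = exp s * (h (- c) - h 0) + (exp s - 1) * F l"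
    by (simp add: h0 algebra_simps)
  have res: "Re s \<le> 0"
    by (simp add: s_def mult.commute)
  have "norm s \<le> pi * (norm c * norm l) + pi * (norm l * norm c) + pi / 2 * (norm c)\<^sup>2"
    unfolding s_def by (intro norm_triangle_le_diff add_mono) (auto simp: norm_mult norm_power)
  also have "\<dots> \<le> pi * (norm c * norm l) + pi * (norm l * norm c) + pi / 2 * (norm c * 1)"
    unfolding power2_eq_square using c by (intro add_mono mult_left_mono) auto
  also have "\<dots> \<le> pi * norm c * (2 * norm l + 1)"
    using pi_ge_zero by (simp add: algebra_simps)
  finally have s: "norm s \<le> pi * norm c * (2 * norm l + 1)" .
  have es: "norm (exp s) \<le> 1"
    using res by simp
  have "norm (weyl_shift c F l - F l) \<le> norm (exp s) * norm (h (- c) - h 0) + norm (exp s - 1) * norm (F l)"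
    unfolding eq by (rule order_trans[OF norm_triangle_ineq]) (simp add: norm_mult)
  also have "\<dots> \<le> 1 * norm (h (- c) - h 0) + (pi * norm c * (2 * norm l + 1)) * norm (F l)"
    using norm_exp_minus_1_le[OF res] s es by (intro add_mono mult_right_mono) auto
  finally have "(norm (weyl_shift c F l - F l))\<^sup>2 \<le> (norm (h (- c) - h 0) + (pi * norm c * (2 * norm l + 1)) * norm (F l))\<^sup>2"
    by (intro power_mono) auto
  also have "\<dots> \<le> 2 * (norm (h (- c) - h 0))\<^sup>2 + 2 * ((pi * norm c * (2 * norm l + 1)) * norm (F l))\<^sup>2"
    using sum_squares_bound[of "norm (h (- c) - h 0)" "(pi * norm c * (2 * norm l + 1)) * norm (F l)"]
    by (simp only: power2_sum)
  also have "((pi * norm c * (2 * norm l + 1)) * norm (F l))\<^sup>2 = (pi\<^sup>2 * (norm c)\<^sup>2 * (norm (F l))\<^sup>2) * (2 * norm l + 1)\<^sup>2"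
    by (simp add: power_mult_distrib mult_ac)
  also have "\<dots> \<le> (pi\<^sup>2 * (norm c)\<^sup>2 * (norm (F l))\<^sup>2) * (8 * (norm l)\<^sup>2 + 2)"
    using sum_squares_bound[of "2 * norm l" 1] by (intro mult_left_mono) (auto simp: power2_sum)
  finally have main: "(norm (weyl_shift c F l - F l))\<^sup>2 \<le> 2 * (norm (h (- c) - h 0))\<^sup>2 +
      2 * ((pi\<^sup>2 * (norm c)\<^sup>2 * (norm (F l))\<^sup>2) * (8 * (norm l)\<^sup>2 + 2))" by simp
  have "fock_density (\<lambda>z. weyl_shift c F z - F z) l = ennreal ((norm (weyl_shift c F l - F l))\<^sup>2 * w)"
    by (simp add: fock_density_def w_def)
  also have "\<dots> \<le> ennreal ((2 * (norm (h (- c) - h 0))\<^sup>2 +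
      2 * ((pi\<^sup>2 * (norm c)\<^sup>2 * (norm (F l))\<^sup>2) * (8 * (norm l)\<^sup>2 + 2))) * w)"
    using main w0 by (intro ennreal_leI mult_right_mono)
  also have "(2 * (norm (h (- c) - h 0))\<^sup>2 +
      2 * ((pi\<^sup>2 * (norm c)\<^sup>2 * (norm (F l))\<^sup>2) * (8 * (norm l)\<^sup>2 + 2))) * w =
      2 * w * (norm (h (- c) - h 0))\<^sup>2 + ((norm c)\<^sup>2 * (16 * pi\<^sup>2 * ((norm l)\<^sup>2 * ((norm (F l))\<^sup>2 * w)))
       + (norm c)\<^sup>2 * (4 * pi\<^sup>2 * ((norm (F l))\<^sup>2 * w)))"
    by (simp add: algebra_simps)
  also have "ennreal \<dots> = ennreal (2 * w) * ennreal ((norm (h (- c) - h 0))\<^sup>2) +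
      (ennreal ((norm c)\<^sup>2) * (ennreal (16 * pi\<^sup>2) * (ennreal ((norm l)\<^sup>2) * fock_density F l)) +
      ennreal ((norm c)\<^sup>2) * (ennreal (4 * pi\<^sup>2) * fock_density F l))"
  proof -
    have "fock_density F l = ennreal ((norm (F l))\<^sup>2 * w)"
      by (simp only: fock_density_def w_def)
    then show ?thesis
      using w0 by (simp add: ennreal_mult ennreal_plus)
  qed
  also have "ennreal (2 * w) * ennreal ((norm (h (- c) - h 0))\<^sup>2) \<le>
      ennreal ((norm c)\<^sup>2) * (ennreal (288 * exp (16 * pi)) * (\<integral>\<^sup>+z. fock_density F z * indicator (cball l 4) z \<partial>lborel))"
  proof -
    define I where "I = (\<integral>\<^sup>+z. ennreal ((norm (h z))\<^sup>2) * indicator (cball 0 4) z \<partial>lborel)"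
    have [measurable]: "h \<in> borel_measurable borel"
      by (rule entire_measurable[OF h])
    have "ennreal w * I = (\<integral>\<^sup>+z. ennreal w * (ennreal ((norm (h z))\<^sup>2) * indicator (cball 0 4) z) \<partial>lborel)"
      unfolding I_def by (rule nn_integral_cmult[symmetric]) measurable
    also have "\<dots> \<le> (\<integral>\<^sup>+z. ennreal (exp (16 * pi)) * (fock_density F (l + z) * indicator (cball l 4) (l + z)) \<partial>lborel)"
    proof (rule nn_integral_mono)
      fix u :: complex
      show "ennreal w * (ennreal ((norm (h u))\<^sup>2) * indicator (cball 0 4) u) \<le>
        ennreal (exp (16 * pi)) * (fock_density F (l + u) * indicator (cball l 4) (l + u))"
      proof (cases "norm u \<le> 4")
        case True
        have "(norm (l + u))\<^sup>2 = (norm l)\<^sup>2 + 2 * Re (cnj l * u) + (norm u)\<^sup>2"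
          using norm_diff_sq[of u "- l"] by (simp add: add.commute)
        then have "- pi * (norm l)\<^sup>2 + 2 * - (pi * Re (cnj l * u)) = pi * (norm u)\<^sup>2 + - pi * (norm (l + u))\<^sup>2"
          by (simp add: algebra_simps)
        then have "exp (- pi * (norm l)\<^sup>2) * (exp (- (pi * Re (cnj l * u))))\<^sup>2 =
            exp (pi * (norm u)\<^sup>2) * exp (- pi * (norm (l + u))\<^sup>2)"
          by (simp only: exp_double[symmetric] exp_add[symmetric])
        moreover have "(norm (h u))\<^sup>2 = (norm (F (l + u)))\<^sup>2 * (exp (- (pi * Re (cnj l * u))))\<^sup>2"
          by (simp add: h_def norm_mult power_mult_distrib mult.assoc)
        ultimately have "w * (norm (h u))\<^sup>2 = exp (pi * (norm u)\<^sup>2) * ((norm (F (l + u)))\<^sup>2 * exp (- pi * (norm (l + u))\<^sup>2))"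
          unfolding w_def by (simp only: mult.left_commute[of _ "(norm (F (l + u)))\<^sup>2"])
        also have "\<dots> \<le> exp (16 * pi) * ((norm (F (l + u)))\<^sup>2 * exp (- pi * (norm (l + u))\<^sup>2))"
          using power_mono[OF True, of 2] by (intro mult_right_mono) (auto simp: mult.commute)
        finally have "ennreal (w * (norm (h u))\<^sup>2) \<le> ennreal (exp (16 * pi) * ((norm (F (l + u)))\<^sup>2 * exp (- pi * (norm (l + u))\<^sup>2)))"
          by (rule ennreal_leI)
        then show ?thesis
          using True w0 by (simp add: fock_density_def ennreal_mult dist_norm)
      qed simp
    qed
    also have "\<dots> = ennreal (exp (16 * pi)) * (\<integral>\<^sup>+z. fock_density F (l + z) * indicator (cball l 4) (l + z) \<partial>lborel)"
      by (rule nn_integral_cmult) measurable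
    also have "(\<integral>\<^sup>+z. fock_density F (l + z) * indicator (cball l 4) (l + z) \<partial>lborel) =
        (\<integral>\<^sup>+z. fock_density F z * indicator (cball l 4) z \<partial>lborel)"
      by (rule nn_integral_lborel_translate[of "\<lambda>z. fock_density F z * indicator (cball l 4) z"]) measurable
    finally have wI: "ennreal w * I \<le> ennreal (exp (16 * pi)) * (\<integral>\<^sup>+z. fock_density F z * indicator (cball l 4) z \<partial>lborel)" .
    have "ennreal (2 * w) * ennreal ((norm (h (- c) - h 0))\<^sup>2) \<le> ennreal (2 * w) * (ennreal (144 * (norm c)\<^sup>2) * I)"
      unfolding I_def using local_Lipschitz_area_bound[OF h, of "- c"] c by (intro mult_left_mono) auto
    also have "\<dots> = ennreal (288 * (norm c)\<^sup>2) * (ennreal w * I)"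
    proof -
      have "ennreal (2 * w) * ennreal (144 * (norm c)\<^sup>2) = ennreal (288 * (norm c)\<^sup>2) * ennreal w"
        using w0 by (simp flip: ennreal_mult)
      then show ?thesis by (simp only: mult.assoc[symmetric])
    qed
    also have "\<dots> \<le> ennreal (288 * (norm c)\<^sup>2) * (ennreal (exp (16 * pi)) * (\<integral>\<^sup>+z. fock_density F z * indicator (cball l 4) z \<partial>lborel))"
      by (intro mult_left_mono wI) auto
    also have "\<dots> = ennreal ((norm c)\<^sup>2) * (ennreal (288 * exp (16 * pi)) * (\<integral>\<^sup>+z. fock_density F z * indicator (cball l 4) z \<partial>lborel))"
    proof -
      have "ennreal (288 * (norm c)\<^sup>2) * ennreal (exp (16 * pi)) = ennreal ((norm c)\<^sup>2) * ennreal (288 * exp (16 * pi))"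
        by (simp flip: ennreal_mult)
      then show ?thesis by (simp only: mult.assoc[symmetric])
    qed
    finally show ?thesis .
  qed
  finally show ?thesis
    by (simp only: distrib_left add.assoc add_right_mono)
qed

context fock_sampling begin

text \<open>Summing the pointwise bound over the sampling points and using the lower sampling inequality: an
  element of the Fock space with \<open>l * F l\<close> square summable is Lipschitz along its orbit under Weyl
  shifts.\<close>

lemma fock_energy_weyl_shift_diff_le:
  assumes F: "F holomorphic_on UNIV" "fock_energy F < \<infinity>"
    and D: "\<And>X. finite X \<Longrightarrow> X \<subseteq> \<Lambda> \<Longrightarrow> (\<Sum>l\<in>X. ennreal ((norm l)\<^sup>2) * fock_density F l) \<le> D" "D < \<infinity>"
  obtains K where "K < \<infinity>" "\<And>c. norm c \<le> 1/2 \<Longrightarrow> fock_energy (\<lambda>z. weyl_shift c F z - F z) \<le> ennreal ((norm c)\<^sup>2) * K"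
proof -
  have Fm[measurable]: "F \<in> borel_measurable borel"
    by (rule entire_measurable[OF F(1)])
  define K where "K = ennreal (288 * exp (16 * pi)) * (ennreal (exp (16 * pi) * B) * fock_energy (\<lambda>_. 1) * fock_energy F)
    + ennreal (16 * pi\<^sup>2) * D + ennreal (4 * pi\<^sup>2) * (ennreal B * fock_energy F)"
  have K: "K < \<infinity>"
    using F(2) D(2) fock_energy_one_finite by (simp add: K_def ennreal_mult_less_top)
  have le: "ennreal A * fock_energy (\<lambda>z. weyl_shift c F z - F z) \<le> ennreal ((norm c)\<^sup>2) * K" if c: "norm c \<le> 1/2" for c
  proof (rule lower)
    have wm[measurable]: "weyl_shift c F \<in> borel_measurable borel"
      by (intro entire_measurable weyl_shift_holomorphic F)
    show "(\<lambda>z. weyl_shift c F z - F z) holomorphic_on UNIV"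
      by (intro holomorphic_on_diff weyl_shift_holomorphic F)
    have "fock_energy (\<lambda>z. weyl_shift c F z + (- 1) * F z) \<le> 2 * fock_energy (weyl_shift c F) + 2 * fock_energy (\<lambda>z. (- 1) * F z)"
      by (rule fock_energy_add_le) measurable
    also have "\<dots> < \<infinity>"
      using F(2) by (simp add: fock_energy_weyl_shift fock_energy_cmult[of F "- 1", simplified] ennreal_mult_less_top)
    finally show "fock_energy (\<lambda>z. weyl_shift c F z - F z) < \<infinity>"
      by simp
  next
    fix X assume X: "finite X" "X \<subseteq> \<Lambda>"
    have "(\<Sum>l\<in>X. fock_density (\<lambda>z. weyl_shift c F z - F z) l) \<le> (\<Sum>l\<in>X. ennreal ((norm c)\<^sup>2) *
        (ennreal (288 * exp (16 * pi)) * (\<integral>\<^sup>+z. fock_density F z * indicator (cball l 4) z \<partial>lborel)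
        + ennreal (16 * pi\<^sup>2) * (ennreal ((norm l)\<^sup>2) * fock_density F l) + ennreal (4 * pi\<^sup>2) * fock_density F l))"
      by (intro sum_mono fock_density_weyl_shift_diff_le F c)
    also have "\<dots> = ennreal ((norm c)\<^sup>2) *
        (ennreal (288 * exp (16 * pi)) * (\<Sum>l\<in>X. \<integral>\<^sup>+z. fock_density F z * indicator (cball l 4) z \<partial>lborel)
        + ennreal (16 * pi\<^sup>2) * (\<Sum>l\<in>X. ennreal ((norm l)\<^sup>2) * fock_density F l) + ennreal (4 * pi\<^sup>2) * (\<Sum>l\<in>X. fock_density F l))"
      by (simp only: sum.distrib sum_distrib_left[symmetric])
    also have "\<dots> \<le> ennreal ((norm c)\<^sup>2) * K"
      unfolding K_def
      by (intro mult_left_mono add_mono D X upper F zero_le sum_ball_integrals_le[of "fock_density F", folded fock_energy_def]) measurable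
    finally show "(\<Sum>l\<in>X. fock_density (\<lambda>z. weyl_shift c F z - F z) l) \<le> ennreal ((norm c)\<^sup>2) * K" .
  qed
  have "fock_energy (\<lambda>z. weyl_shift c F z - F z) \<le> ennreal ((norm c)\<^sup>2) * (ennreal (1 / A) * K)" if c: "norm c \<le> 1/2" for c
  proof -
    have "fock_energy (\<lambda>z. weyl_shift c F z - F z) = ennreal (1 / A) * (ennreal A * fock_energy (\<lambda>z. weyl_shift c F z - F z))"
      using A_pos by (simp add: mult.assoc[symmetric] ennreal_mult[symmetric])
    also have "\<dots> \<le> ennreal (1 / A) * (ennreal ((norm c)\<^sup>2) * K)"
      by (intro mult_left_mono le c) auto
    finally show ?thesis by (simp add: mult_ac)
  qed
  then show thesis
    using K by (intro that[of "ennreal (1 / A) * K"]) (auto simp: ennreal_mult_less_top)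
qed

end

text \<open>The function on the left is the derivative of \<open>t \<mapsto> weyl_shift (t * e) F\<close> at \<open>t = 0\<close>; the bound passes
  to the limit of the difference quotients by Fatou's lemma.\<close>

lemma fock_energy_derivative_of_weyl_shift_le:
  assumes F: "F holomorphic_on UNIV" and e: "norm e = 1"
    and K: "\<And>c. norm c \<le> 1/2 \<Longrightarrow> fock_energy (\<lambda>z. weyl_shift c F z - F z) \<le> ennreal ((norm c)\<^sup>2) * K"
  shows "fock_energy (\<lambda>z. of_real pi * cnj e * z * F z - e * deriv F z) \<le> K"
proof -
  have Fm[measurable]: "F \<in> borel_measurable borel"
    by (rule entire_measurable[OF F])
  \<comment> \<open>A null sequence in \<open>(0, 1/2]\<close>, where the assumed bound is available.\<close>
  define t where "t n = 1 / (real n + 2)" for n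
  have t: "t n > 0" "t n \<le> 1/2" for n
    by (auto simp: t_def field_simps)
  have t0: "t \<longlonglongrightarrow> 0"
    unfolding t_def by real_asymp
  define Q where "Q n z = (weyl_shift (of_real (t n) * e) F z - F z) / of_real (t n)" for n z
  have wm[measurable]: "weyl_shift c F \<in> borel_measurable borel" for c
    by (intro entire_measurable weyl_shift_holomorphic F)
  have lim: "(\<lambda>n. Q n z) \<longlonglongrightarrow> of_real pi * cnj e * z * F z - e * deriv F z" for z
  proof -
    define p where "p u = exp (of_real pi * cnj e * u * z - of_real (pi / 2) * u\<^sup>2) * F (z - u * e)" for u :: complex
    have "(F has_field_derivative deriv F z) (at z)"
      by (rule holomorphic_derivI[OF F]) auto
    then have F': "(F has_field_derivative deriv F z) (at (z - 0 * e))" by simp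
    have "(p has_field_derivative (of_real pi * cnj e * z * F z - e * deriv F z)) (at 0)"
    proof -
      have "((\<lambda>u. z - u * e) has_field_derivative - e) (at 0)"
        by (rule derivative_eq_intros refl | simp)+
      from DERIV_chain2[where f = F and g = "\<lambda>u. z - u * e", OF F' this]
      have d: "((\<lambda>u. F (z - u * e)) has_field_derivative deriv F z * - e) (at 0)" .
      have d2: "((\<lambda>u. exp (of_real pi * cnj e * u * z - of_real (pi / 2) * u\<^sup>2)) has_field_derivative of_real pi * cnj e * z) (at 0)"
        by (rule derivative_eq_intros refl | simp)+
      show ?thesis
        using DERIV_mult[OF d2 d] unfolding p_def by (simp add: algebra_simps)
    qed
    then have l: "((\<lambda>u. (p u - p 0) / u) \<longlongrightarrow> of_real pi * cnj e * z * F z - e * deriv F z) (at 0)"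
      by (simp add: has_field_derivative_iff)
    have "filterlim (\<lambda>n. complex_of_real (t n)) (at 0) sequentially"
      unfolding filterlim_at using tendsto_of_real[OF t0, where 'a = complex] t(1)
      by (simp add: less_imp_neq[symmetric])
    from filterlim_compose[OF l this]
    have "(\<lambda>n. (p (of_real (t n)) - p 0) / of_real (t n)) \<longlonglongrightarrow> of_real pi * cnj e * z * F z - e * deriv F z" .
    moreover have "p (of_real (t n)) = weyl_shift (of_real (t n) * e) F z" for n
      using t(1)[of n] e by (simp add: p_def weyl_shift_def norm_mult mult_ac)
    moreover have "p 0 = F z" by (simp add: p_def)
    ultimately show ?thesis by (simp add: Q_def)
  qed
  have dlim: "fock_density (\<lambda>z. of_real pi * cnj e * z * F z - e * deriv F z) z = liminf (\<lambda>n. fock_density (Q n) z)" for z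
  proof -
    have "(\<lambda>n. fock_density (Q n) z) \<longlonglongrightarrow> fock_density (\<lambda>z. of_real pi * cnj e * z * F z - e * deriv F z) z"
      unfolding fock_density_def by (intro tendsto_intros lim)
    then show ?thesis
      by (simp add: lim_imp_Liminf)
  qed
  have [measurable]: "Q n \<in> borel_measurable borel" for n
    unfolding Q_def[abs_def] by measurable
  have "fock_energy (\<lambda>z. of_real pi * cnj e * z * F z - e * deriv F z) = (\<integral>\<^sup>+z. liminf (\<lambda>n. fock_density (Q n) z) \<partial>lborel)"
    unfolding fock_energy_def dlim ..
  also have "\<dots> \<le> liminf (\<lambda>n. fock_energy (Q n))"
    unfolding fock_energy_def by (rule nn_integral_liminf) measurable
  also have "\<dots> \<le> K"
  proof -
    have "fock_energy (Q n) \<le> K" for n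
    proof -
      have "fock_energy (Q n) = fock_energy (\<lambda>z. of_real (1 / t n) * (weyl_shift (of_real (t n) * e) F z - F z))"
        by (simp add: Q_def[abs_def])
      also have "\<dots> = ennreal ((1 / t n)\<^sup>2) * fock_energy (\<lambda>z. weyl_shift (of_real (t n) * e) F z - F z)"
        using t(1)[of n] by (subst fock_energy_cmult) (auto simp: norm_divide power_divide)
      also have "\<dots> \<le> ennreal ((1 / t n)\<^sup>2) * (ennreal ((norm (of_real (t n) * e))\<^sup>2) * K)"
        using t[of n] e by (intro mult_left_mono K) (auto simp: norm_mult)
      also have "\<dots> = K"
        using t(1)[of n] e by (simp add: norm_mult mult.assoc[symmetric] ennreal_mult[symmetric] power_divide)
      finally show ?thesis .
    qed
    then show ?thesis
      by (intro Liminf_le) auto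
  qed
  finally show ?thesis .
qed

context fock_sampling begin

text \<open>The derivatives along \<open>1\<close> and \<open>\<i>\<close> are \<open>pi * z * F - F'\<close> and \<open>- \<i> * (pi * z * F + F')\<close>; a combination of
  them isolates \<open>z * F\<close>.\<close>

lemma fock_energy_mult_z_finite:
  assumes F: "F holomorphic_on UNIV" "fock_energy F < \<infinity>"
    and D: "\<And>X. finite X \<Longrightarrow> X \<subseteq> \<Lambda> \<Longrightarrow> (\<Sum>l\<in>X. ennreal ((norm l)\<^sup>2) * fock_density F l) \<le> D" "D < \<infinity>"
  shows "fock_energy (\<lambda>z. z * F z) < \<infinity>"
proof -
  have Fm[measurable]: "F \<in> borel_measurable borel" "deriv F \<in> borel_measurable borel"
    by (intro entire_measurable F holomorphic_deriv open_UNIV)+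
  obtain K where K: "K < \<infinity>" "\<And>c. norm c \<le> 1/2 \<Longrightarrow> fock_energy (\<lambda>z. weyl_shift c F z - F z) \<le> ennreal ((norm c)\<^sup>2) * K"
    using fock_energy_weyl_shift_diff_le[OF F D] by blast
  \<comment> \<open>Written with \<open>cnj 1\<close> and \<open>cnj \<i>\<close> to match the derivative of the Weyl shift in the directions \<open>1\<close> and \<open>\<i>\<close>.\<close>
  let ?P = "\<lambda>z. of_real pi * cnj 1 * z * F z - 1 * deriv F z"
  let ?M = "\<lambda>z. of_real pi * cnj \<i> * z * F z - \<i> * deriv F z"
  have eq: "z * F z = of_real (1 / (2 * pi)) * (?P z + \<i> * ?M z)" for z
    by (simp add: field_simps)
  have "fock_energy (\<lambda>z. ?P z + \<i> * ?M z) \<le> 2 * fock_energy ?P + 2 * fock_energy (\<lambda>z. \<i> * ?M z)"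
    by (rule fock_energy_add_le) measurable
  also have "fock_energy (\<lambda>z. \<i> * ?M z) = fock_energy ?M"
    by (subst fock_energy_cmult) auto
  also have "2 * fock_energy ?P + 2 * fock_energy ?M \<le> 2 * K + 2 * K"
    using K(2) by (intro add_mono mult_left_mono fock_energy_derivative_of_weyl_shift_le F) auto
  also have "\<dots> < \<infinity>"
    using K(1) by (simp add: ennreal_mult_less_top)
  finally have fin: "fock_energy (\<lambda>z. ?P z + \<i> * ?M z) < \<infinity>" .
  have "fock_energy (\<lambda>z. z * F z) = ennreal ((norm (of_real (1 / (2 * pi)) :: complex))\<^sup>2) * fock_energy (\<lambda>z. ?P z + \<i> * ?M z)"
    unfolding eq by (rule fock_energy_cmult) measurable
  with fin show ?thesis by (simp add: ennreal_mult_less_top)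
qed

end

section \<open>A Liouville theorem for sampling sets\<close>

lemma cosh_norm_measurable [measurable]: "(\<lambda>z::complex. cosh (a * norm z)) \<in> borel_measurable borel"
  by (intro borel_measurable_continuous_onI continuous_intros)

text \<open>The hyperbolic cosine dominates half of the exponential, and its power series has nonnegative
  coefficients and even powers only. Even powers \<open>|z| ^ (2 * k)\<close> are squared moduli of \<open>z ^ k\<close>, so the
  expansion involves nothing but energies of \<open>z ^ k * F\<close>.\<close>

lemma nn_integral_fock_density_cosh:
  assumes [measurable]: "F \<in> borel_measurable borel"
  shows "(\<integral>\<^sup>+z. fock_density F z * ennreal (cosh (a * norm z)) \<partial>lborel) =
    (\<Sum>n. ennreal (if even n then a ^ n / fact n else 0) * fock_energy (\<lambda>z. z ^ (n div 2) * F z))"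
proof -
  define b where "b n = (if even n then a ^ n / fact n else 0)" for n :: nat
  have b0: "b n \<ge> 0" for n
    by (simp add: b_def zero_le_even_power)
  have dens_term: "fock_density F z * ennreal (b n * norm z ^ n) = ennreal (b n) * fock_density (\<lambda>z. z ^ (n div 2) * F z) z" for n z
  proof (cases "even n")
    case True
    then have "norm z ^ n = (norm (z ^ (n div 2)))\<^sup>2"
      by (simp add: norm_power power_mult[symmetric])
    then have "fock_density (\<lambda>z. z ^ (n div 2) * F z) z = ennreal (norm z ^ n) * fock_density F z"
      by (simp add: fock_density_def norm_mult power_mult_distrib ennreal_mult mult.assoc)
    then show ?thesis
      using b0[of n] by (simp add: ennreal_mult mult_ac)
  qed (simp add: b_def)
  have "ennreal (cosh (a * norm z)) = (\<Sum>n. ennreal (b n * norm z ^ n))" for z :: complex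
  proof -
    have "(\<lambda>n. b n * norm z ^ n) = (\<lambda>n. if even n then (a * norm z) ^ n /\<^sub>R fact n else 0)"
      by (auto simp: b_def power_mult_distrib field_simps)
    then have "(\<lambda>n. b n * norm z ^ n) sums cosh (a * norm z)"
      using cosh_converges[of "a * norm z"] by simp
    then show ?thesis
      using b0 by (intro suminf_ennreal_eq[symmetric]) auto
  qed
  then have "(\<integral>\<^sup>+z. fock_density F z * ennreal (cosh (a * norm z)) \<partial>lborel) =
      (\<integral>\<^sup>+z. (\<Sum>n. ennreal (b n) * fock_density (\<lambda>z. z ^ (n div 2) * F z) z) \<partial>lborel)"
    by (simp flip: dens_term)
  also have "\<dots> = (\<Sum>n. ennreal (b n) * fock_energy (\<lambda>z. z ^ (n div 2) * F z))"
    unfolding fock_energy_def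
    by (subst nn_integral_suminf) (auto simp: nn_integral_cmult)
  finally show ?thesis unfolding b_def .
qed

lemma nn_integral_fock_density_one_cosh_finite:
  assumes "a \<ge> 0"
  shows "(\<integral>\<^sup>+z. fock_density (\<lambda>_. 1) z * ennreal (cosh (a * norm z)) \<partial>lborel) < \<infinity>"
proof -
  have "fock_density (\<lambda>_. 1) z * ennreal (cosh (a * norm z)) \<le>
      ennreal (exp (a\<^sup>2 / (2 * pi))) * ennreal (exp (- (pi / 2) * (norm z)\<^sup>2))" for z
  proof -
    define t where "t = norm z"
    have "cosh (a * t) \<le> exp (a * t)"
      using assms by (simp add: cosh_def t_def)
    then have "exp (- pi * t\<^sup>2) * cosh (a * t) \<le> exp (- pi * t\<^sup>2 + a * t)"
      unfolding exp_add by (intro mult_left_mono) auto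
    also have "\<dots> \<le> exp (a\<^sup>2 / (2 * pi) + - (pi / 2) * t\<^sup>2)"
    proof -
      have "a\<^sup>2 / (2 * pi) - (pi / 2) * t\<^sup>2 - (- pi * t\<^sup>2 + a * t) = (a - pi * t)\<^sup>2 / (2 * pi)"
        by (simp add: field_simps power2_eq_square)
      also have "\<dots> \<ge> 0" by simp
      finally show ?thesis by simp
    qed
    finally show ?thesis
      unfolding exp_add
      by (simp add: fock_density_def t_def ennreal_mult[symmetric] ennreal_leI)
  qed
  then have "(\<integral>\<^sup>+z. fock_density (\<lambda>_. 1) z * ennreal (cosh (a * norm z)) \<partial>lborel) \<le>
      (\<integral>\<^sup>+z. ennreal (exp (a\<^sup>2 / (2 * pi))) * ennreal (exp (- (pi / 2) * (norm (z::complex))\<^sup>2)) \<partial>lborel)"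
    by (rule nn_integral_mono)
  also have "\<dots> = ennreal (exp (a\<^sup>2 / (2 * pi))) * (\<integral>\<^sup>+z. ennreal (exp (- (pi / 2) * (norm (z::complex))\<^sup>2)) \<partial>lborel)"
    by (rule nn_integral_cmult) measurable
  also have "\<dots> < \<infinity>"
    using nn_integral_gaussian_complex_finite[of "pi / 2"] by (simp add: ennreal_mult_less_top)
  finally show ?thesis .
qed

lemma fock_energy_power_finite: "fock_energy (\<lambda>z. z ^ k) < \<infinity>"
proof -
  let ?f = "\<lambda>n. ennreal (if even n then 1 ^ n / fact n else 0) * fock_energy (\<lambda>z. z ^ (n div 2) * 1)"
  have fin: "(\<Sum>n. ?f n) < \<infinity>"
    using nn_integral_fock_density_one_cosh_finite[of 1] by (subst nn_integral_fock_density_cosh[symmetric]) auto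
  have "sum ?f {2 * k} \<le> (\<Sum>n. ?f n)"
    by (rule sum_le_suminf) auto
  with fin have "?f (2 * k) < \<infinity>"
    by (simp only: sum.insert_remove sum.empty finite.intros) (auto intro: le_less_trans)
  then show ?thesis
    by (auto simp: ennreal_mult_less_top)
qed

context fock_sampling begin

context
  fixes G :: "complex \<Rightarrow> complex" and C :: real
  assumes G: "G holomorphic_on UNIV" "fock_energy G < \<infinity>"
    and bound: "\<And>l. l \<in> \<Lambda> \<Longrightarrow> norm (G l) \<le> C"
begin

lemma sum_fock_density_mult_le:
  assumes P: "P holomorphic_on UNIV" "fock_energy P < \<infinity>" and X: "finite X" "X \<subseteq> \<Lambda>"
  shows "(\<Sum>l\<in>X. fock_density (\<lambda>z. P z * G z) l) \<le> ennreal (C\<^sup>2) * (ennreal B * fock_energy P)"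
proof -
  have "fock_density (\<lambda>z. P z * G z) l \<le> ennreal (C\<^sup>2) * fock_density P l" if "l \<in> \<Lambda>" for l
  proof -
    have "(norm (G l))\<^sup>2 \<le> C\<^sup>2"
      using bound[OF that] by (intro power_mono) auto
    then have "(norm (G l))\<^sup>2 * ((norm (P l))\<^sup>2 * exp (- pi * (norm l)\<^sup>2)) \<le> C\<^sup>2 * ((norm (P l))\<^sup>2 * exp (- pi * (norm l)\<^sup>2))"
      by (intro mult_right_mono) auto
    then show ?thesis
      by (simp add: fock_density_def norm_mult power_mult_distrib ennreal_mult[symmetric] ennreal_leI mult_ac)
  qed
  then have "(\<Sum>l\<in>X. fock_density (\<lambda>z. P z * G z) l) \<le> (\<Sum>l\<in>X. ennreal (C\<^sup>2) * fock_density P l)"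
    using X by (intro sum_mono) auto
  also have "\<dots> = ennreal (C\<^sup>2) * (\<Sum>l\<in>X. fock_density P l)"
    by (rule sum_distrib_left[symmetric])
  also have "\<dots> \<le> ennreal (C\<^sup>2) * (ennreal B * fock_energy P)"
    by (intro mult_left_mono upper P X) auto
  finally show ?thesis .
qed

text \<open>Sample \<open>P * G\<close> from below and \<open>P\<close> from above. The Liouville theorem uses this for powers, to
  integrate \<open>|G|\<^sup>2\<close> against exponentials, and for reproducing kernels, to localise.\<close>

lemma fock_energy_mult_le:
  assumes P: "P holomorphic_on UNIV" "fock_energy P < \<infinity>" and PG: "fock_energy (\<lambda>z. P z * G z) < \<infinity>"
  shows "fock_energy (\<lambda>z. P z * G z) \<le> ennreal (C\<^sup>2 * B / A) * fock_energy P"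
proof -
  have "ennreal A * fock_energy (\<lambda>z. P z * G z) \<le> ennreal (C\<^sup>2) * (ennreal B * fock_energy P)"
    by (intro lower sum_fock_density_mult_le P PG holomorphic_intros G)
  then have "ennreal (1 / A) * (ennreal A * fock_energy (\<lambda>z. P z * G z)) \<le> ennreal (1 / A) * (ennreal (C\<^sup>2) * (ennreal B * fock_energy P))"
    by (intro mult_left_mono) auto
  then show ?thesis
    using A_pos B_pos by (simp add: mult.assoc[symmetric] ennreal_mult[symmetric])
qed

text \<open>The samples of \<open>z * z ^ n * G\<close> are at most \<open>C\<close> times those of \<open>z ^ (n + 1)\<close>, hence square summable, and
  the regularity result carries the induction.\<close>

lemma fock_energy_power_mult_finite: "fock_energy (\<lambda>z. z ^ n * G z) < \<infinity>"
proof (induction n)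
  case 0
  then show ?case using G by simp
next
  case (Suc n)
  have "fock_energy (\<lambda>z. z * (z ^ n * G z)) < \<infinity>"
  proof (rule fock_energy_mult_z_finite)
    show "(\<lambda>z. z ^ n * G z) holomorphic_on UNIV"
      by (intro holomorphic_intros G)
    show "ennreal (C\<^sup>2) * (ennreal B * fock_energy (\<lambda>z. z ^ Suc n)) < \<infinity>"
      using fock_energy_power_finite[of "Suc n"] by (simp add: ennreal_mult_less_top)
    fix X assume X: "finite X" "X \<subseteq> \<Lambda>"
    have "(\<Sum>l\<in>X. ennreal ((norm l)\<^sup>2) * fock_density (\<lambda>z. z ^ n * G z) l) = (\<Sum>l\<in>X. fock_density (\<lambda>z. z ^ Suc n * G z) l)"
      by (intro sum.cong) (simp_all add: fock_density_def norm_mult power_mult_distrib ennreal_mult mult_ac)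
    also have "\<dots> \<le> ennreal (C\<^sup>2) * (ennreal B * fock_energy (\<lambda>z. z ^ Suc n))"
      by (intro sum_fock_density_mult_le X fock_energy_power_finite holomorphic_intros)
    finally show "(\<Sum>l\<in>X. ennreal ((norm l)\<^sup>2) * fock_density (\<lambda>z. z ^ n * G z) l) \<le>
        ennreal (C\<^sup>2) * (ennreal B * fock_energy (\<lambda>z. z ^ Suc n))" .
  qed (use Suc in simp)
  then show ?case by (simp add: mult.assoc)
qed

text \<open>Comparing coefficients with the expansion for the constant function \<open>1\<close>, where the integral is a
  Gaussian one.\<close>

lemma nn_integral_fock_density_cosh_finite:
  assumes a: "a \<ge> 0"
  shows "(\<integral>\<^sup>+z. fock_density G z * ennreal (cosh (a * norm z)) \<partial>lborel) < \<infinity>"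
proof -
  have Gm: "G \<in> borel_measurable borel"
    by (rule entire_measurable[OF G(1)])
  let ?b = "\<lambda>n. ennreal (if even n then a ^ n / fact n else 0)"
  have "(\<integral>\<^sup>+z. fock_density G z * ennreal (cosh (a * norm z)) \<partial>lborel) =
      (\<Sum>n. ?b n * fock_energy (\<lambda>z. z ^ (n div 2) * G z))"
    by (rule nn_integral_fock_density_cosh[OF Gm])
  also have "\<dots> \<le> (\<Sum>n. ?b n * (ennreal (C\<^sup>2 * B / A) * fock_energy (\<lambda>z. z ^ (n div 2))))"
    by (intro suminf_le mult_left_mono fock_energy_mult_le fock_energy_power_mult_finite fock_energy_power_finite holomorphic_intros) auto
  also have "\<dots> = (\<Sum>n. ennreal (C\<^sup>2 * B / A) * (?b n * fock_energy (\<lambda>z. z ^ (n div 2) * 1)))"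
    by (simp add: mult.left_commute)
  also have "\<dots> = ennreal (C\<^sup>2 * B / A) * (\<integral>\<^sup>+z. fock_density (\<lambda>_. 1) z * ennreal (cosh (a * norm z)) \<partial>lborel)"
    by (subst nn_integral_fock_density_cosh) auto
  also have "\<dots> < \<infinity>"
    using nn_integral_fock_density_one_cosh_finite[OF a] by (simp add: ennreal_mult_less_top)
  finally show ?thesis .
qed

lemma fock_density_weyl_shift_one_mult:
  "fock_density (\<lambda>z. weyl_shift w (\<lambda>_. 1) z * G z) z = ennreal ((norm (G z))\<^sup>2 * exp (- pi * (norm (z - w))\<^sup>2))"
proof -
  have "fock_density (\<lambda>z. weyl_shift w (\<lambda>_. 1) z * G z) z = ennreal ((norm (G z))\<^sup>2) * fock_density (weyl_shift w (\<lambda>_. 1)) z"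
    by (simp add: fock_density_def norm_mult power_mult_distrib ennreal_mult[symmetric] mult_ac)
  also have "\<dots> = ennreal ((norm (G z))\<^sup>2 * exp (- pi * (norm (z - w))\<^sup>2))"
    unfolding fock_density_weyl_shift by (simp add: fock_density_def ennreal_mult)
  finally show ?thesis .
qed

lemma fock_energy_weyl_shift_one_mult_finite:
  "fock_energy (\<lambda>z. weyl_shift w (\<lambda>_. 1) z * G z) < \<infinity>"
proof -
  have Gm[measurable]: "G \<in> borel_measurable borel"
    by (rule entire_measurable[OF G(1)])
  have "fock_density (\<lambda>z. weyl_shift w (\<lambda>_. 1) z * G z) z \<le> 2 * (fock_density G z * ennreal (cosh (2 * pi * norm w * norm z)))" for z
  proof -
    have "Re (cnj w * z) \<le> norm (cnj w * z)"
      by (rule complex_Re_le_cmod)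
    then have "pi * (Re (cnj w * z)) \<le> pi * (norm w * norm z)"
      by (intro mult_left_mono) (auto simp: norm_mult)
    moreover have "0 \<le> pi * (norm w)\<^sup>2" by simp
    moreover have "- pi * (norm (z - w))\<^sup>2 = - pi * (norm z)\<^sup>2 + 2 * (pi * Re (cnj w * z)) - pi * (norm w)\<^sup>2"
      unfolding norm_diff_sq by (simp only: algebra_simps)
    ultimately have "- pi * (norm (z - w))\<^sup>2 \<le> - pi * (norm z)\<^sup>2 + 2 * pi * norm w * norm z"
      by linarith
    then have "exp (- pi * (norm (z - w))\<^sup>2) \<le> exp (- pi * (norm z)\<^sup>2) * exp (2 * pi * norm w * norm z)"
      by (simp add: exp_add[symmetric])
    also have "\<dots> \<le> exp (- pi * (norm z)\<^sup>2) * (2 * cosh (2 * pi * norm w * norm z))"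
      by (intro mult_left_mono) (auto simp: cosh_def)
    finally have "(norm (G z))\<^sup>2 * exp (- pi * (norm (z - w))\<^sup>2) \<le>
        (norm (G z))\<^sup>2 * (exp (- pi * (norm z)\<^sup>2) * (2 * cosh (2 * pi * norm w * norm z)))"
      by (intro mult_left_mono) auto
    also have "\<dots> = 2 * (((norm (G z))\<^sup>2 * exp (- pi * (norm z)\<^sup>2)) * cosh (2 * pi * norm w * norm z))"
      by simp
    finally have "ennreal ((norm (G z))\<^sup>2 * exp (- pi * (norm (z - w))\<^sup>2)) \<le>
      ennreal (2 * (((norm (G z))\<^sup>2 * exp (- pi * (norm z)\<^sup>2)) * cosh (2 * pi * norm w * norm z)))"
      by (rule ennreal_leI)
    also have "\<dots> = 2 * (fock_density G z * ennreal (cosh (2 * pi * norm w * norm z)))"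
      unfolding fock_density_def by (subst ennreal_mult, simp, simp add: cosh_real_nonneg)+ simp
    finally show ?thesis
      unfolding fock_density_weyl_shift_one_mult .
  qed
  then have "fock_energy (\<lambda>z. weyl_shift w (\<lambda>_. 1) z * G z) \<le> (\<integral>\<^sup>+z. 2 * (fock_density G z * ennreal (cosh (2 * pi * norm w * norm z))) \<partial>lborel)"
    unfolding fock_energy_def by (rule nn_integral_mono)
  also have "\<dots> = 2 * (\<integral>\<^sup>+z. fock_density G z * ennreal (cosh (2 * pi * norm w * norm z)) \<partial>lborel)"
    by (rule nn_integral_cmult) measurable
  also have "\<dots> < \<infinity>"
    using nn_integral_fock_density_cosh_finite[of "2 * pi * norm w"] by (simp add: ennreal_mult_less_top)
  finally show ?thesis .
qed

text \<open>On the disc of radius \<open>3\<close> around \<open>w\<close> the Gaussian bump of the kernel at \<open>w\<close> is at least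
  \<open>exp (- 9 * pi)\<close>, so that the energy of kernel times \<open>G\<close> dominates the mean of \<open>|G|\<^sup>2\<close> there.\<close>

theorem bounded_on_sampling_set_imp_constant: "\<exists>c. \<forall>z. G z = c"
proof -
  have wm[measurable]: "weyl_shift w (\<lambda>_. 1) \<in> borel_measurable borel" for w
    by (intro entire_measurable weyl_shift_holomorphic) auto
  have Gm[measurable]: "G \<in> borel_measurable borel"
    by (rule entire_measurable[OF G(1)])
  define M where "M = ennreal (36 * exp (9 * pi)) * (ennreal (C\<^sup>2 * B / A) * fock_energy (\<lambda>_. 1))"
  have M: "M < \<infinity>"
    using fock_energy_one_finite by (simp add: M_def ennreal_mult_less_top)
  have le: "ennreal ((norm (G w))\<^sup>2) \<le> M" for w
  proof -
    have "ennreal ((norm (G z))\<^sup>2) * indicator (cball w 3) z \<le>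
        ennreal (exp (9 * pi)) * fock_density (\<lambda>z. weyl_shift w (\<lambda>_. 1) z * G z) z" for z
    proof (cases "z \<in> cball w 3")
      case True
      then have "(norm (z - w))\<^sup>2 \<le> 3\<^sup>2"
        by (intro power_mono) (auto simp: dist_norm norm_minus_commute)
      then have "1 \<le> exp (9 * pi + - pi * (norm (z - w))\<^sup>2)"
        by (simp add: mult.commute)
      then have "(norm (G z))\<^sup>2 * 1 \<le> (norm (G z))\<^sup>2 * (exp (9 * pi) * exp (- pi * (norm (z - w))\<^sup>2))"
        unfolding exp_add by (intro mult_left_mono) auto
      then show ?thesis
        using True unfolding fock_density_weyl_shift_one_mult
        by (simp add: ennreal_mult[symmetric] ennreal_leI mult_ac)
    qed simp
    then have "(\<integral>\<^sup>+z. ennreal ((norm (G z))\<^sup>2) * indicator (cball w 3) z \<partial>lborel) \<le>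
        (\<integral>\<^sup>+z. ennreal (exp (9 * pi)) * fock_density (\<lambda>z. weyl_shift w (\<lambda>_. 1) z * G z) z \<partial>lborel)"
      by (rule nn_integral_mono)
    also have "\<dots> = ennreal (exp (9 * pi)) * fock_energy (\<lambda>z. weyl_shift w (\<lambda>_. 1) z * G z)"
      unfolding fock_energy_def
      by (intro nn_integral_cmult fock_density_measurable) measurable
    also have "\<dots> \<le> ennreal (exp (9 * pi)) * (ennreal (C\<^sup>2 * B / A) * fock_energy (weyl_shift w (\<lambda>_. 1)))"
      using fock_energy_one_finite
      by (intro mult_left_mono fock_energy_mult_le weyl_shift_holomorphic fock_energy_weyl_shift_one_mult_finite)
        (auto simp: fock_energy_weyl_shift)
    finally have "36 * (\<integral>\<^sup>+z. ennreal ((norm (G z))\<^sup>2) * indicator (cball w 3) z \<partial>lborel) \<le>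
        36 * (ennreal (exp (9 * pi)) * (ennreal (C\<^sup>2 * B / A) * fock_energy (weyl_shift w (\<lambda>_. 1))))"
      by (rule mult_left_mono) simp
    also have "\<dots> = M"
      by (simp add: M_def fock_energy_weyl_shift ennreal_mult mult.assoc)
    finally show ?thesis
      using norm_sq_le_area_integral[OF G(1), of w] by (rule order_trans[rotated])
  qed
  obtain m where m: "m \<ge> 0" "M = ennreal m"
    using M by (cases M) auto
  have "norm (G w) \<le> sqrt m" for w
    using le[of w] m by (simp add: real_le_rsqrt)
  then have "bounded (range G)"
    by (auto simp: bounded_iff)
  then show ?thesis
    using Liouville_theorem[OF G(1)] unfolding constant_on_def by auto
qed

end
end

section \<open>Fourier transforms of integrable functions\<close>

text \<open>The sign of the exponent is positive because the Fourier transform is applied to conjugated signals.\<close>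

definition fourier :: "(real \<Rightarrow> complex) \<Rightarrow> real \<Rightarrow> complex" where
  "fourier p \<omega> = (LINT t|lborel. p t * iexp (2 * pi * \<omega> * t))"

lemma fourier_integrable:
  assumes "integrable lborel p"
  shows "integrable lborel (\<lambda>t. p t * iexp (2 * pi * \<omega> * t))"
  by (rule Bochner_Integration.integrable_bound[OF assms]) (use assms in \<open>auto simp: norm_mult\<close>)

lemma fourier_measurable [measurable]:
  assumes [measurable]: "p \<in> borel_measurable borel"
  shows "fourier p \<in> borel_measurable borel"
  unfolding fourier_def[abs_def] by measurable

lemma norm_fourier_le: "norm (fourier p \<omega>) \<le> (LINT t|lborel. norm (p t))"
proof -
  have "norm (fourier p \<omega>) \<le> (LINT t|lborel. norm (p t * iexp (2 * pi * \<omega> * t)))"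
    unfolding fourier_def by (rule integral_norm_bound)
  then show ?thesis by (simp add: norm_mult)
qed

lemma cnj_fourier: "cnj (fourier p \<omega>) = (LINT t|lborel. cnj (p t) * iexp (- (2 * pi * \<omega> * t)))"
proof -
  have "cnj (p t * iexp (2 * pi * \<omega> * t)) = cnj (p t) * iexp (- (2 * pi * \<omega> * t))" for t
    by (simp add: exp_cnj)
  moreover have "cnj (fourier p \<omega>) = (LINT t|lborel. cnj (p t * iexp (2 * pi * \<omega> * t)))"
    unfolding fourier_def by (simp only: Bochner_Integration.integral_cnj)
  ultimately show ?thesis
    by (simp only:)
qed

lemma fourier_multiplication_formula:
  assumes p: "integrable lborel p" and q: "integrable lborel q"
  shows "(LINT \<omega>|lborel. q \<omega> * fourier p \<omega>) = (LINT t|lborel. p t * fourier q t)"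
proof -
  have [measurable]: "p \<in> borel_measurable borel" "q \<in> borel_measurable borel"
    using p q by (auto dest: borel_measurable_integrable)
  let ?K = "\<lambda>\<omega> t. q \<omega> * (p t * iexp (2 * pi * \<omega> * t))"
  have "integrable (lborel \<Otimes>\<^sub>M lborel) (\<lambda>(\<omega>, t). ?K \<omega> t)"
  proof (rule lborel_pair.Fubini_integrable)
    show "integrable lborel (\<lambda>\<omega>. LINT t|lborel. norm (case (\<omega>, t) of (\<omega>, t) \<Rightarrow> ?K \<omega> t))"
      using p q by (simp add: norm_mult)
    show "AE \<omega> in lborel. integrable lborel (\<lambda>t. case (\<omega>, t) of (\<omega>, t) \<Rightarrow> ?K \<omega> t)"
      using fourier_integrable[OF p] by simp
  qed measurable
  then have "(LINT t|lborel. LINT \<omega>|lborel. ?K \<omega> t) = (LINT \<omega>|lborel. LINT t|lborel. ?K \<omega> t)"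
    by (rule lborel_pair.Fubini_integral)
  moreover have "(LINT \<omega>|lborel. ?K \<omega> t) = p t * fourier q t" for t
    unfolding fourier_def integral_mult_right_zero[symmetric]
    by (intro Bochner_Integration.integral_cong) (simp_all add: mult_ac)
  moreover have "(LINT t|lborel. ?K \<omega> t) = q \<omega> * fourier p \<omega>" for \<omega>
    by (simp add: fourier_def)
  ultimately show ?thesis by (simp only:)
qed

lemma fourier_normal_density:
  assumes s: "s > 0"
  shows "fourier (\<lambda>t. of_real (normal_density 0 s t)) \<omega> = of_real (exp (- 2 * pi\<^sup>2 * s\<^sup>2 * \<omega>\<^sup>2))"
proof -
  have nd: "s * normal_density 0 s (s * x) = std_normal_density x" for x
    using s by (simp add: normal_density_def real_sqrt_mult power_mult_distrib)
  have "fourier (\<lambda>t. of_real (normal_density 0 s t)) \<omega> =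
      \<bar>s\<bar> *\<^sub>R (LINT x|lborel. of_real (normal_density 0 s (0 + s * x)) * iexp (2 * pi * \<omega> * (0 + s * x)))"
    unfolding fourier_def using s by (intro lborel_integral_real_affine) auto
  also have "\<dots> = (LINT x|lborel. of_real (s * normal_density 0 s (s * x)) * iexp (2 * pi * \<omega> * s * x))"
    using s by (simp add: scaleR_conv_of_real integral_mult_right_zero[symmetric] mult_ac del: integral_mult_right_zero)
  also have "\<dots> = (CLINT x|std_normal_distribution. iexp (2 * pi * \<omega> * s * x))"
    unfolding nd by (subst integral_density) (auto simp: scaleR_conv_of_real)
  also have "\<dots> = char std_normal_distribution (2 * pi * \<omega> * s)"
    by (simp add: char_def)
  also have "\<dots> = of_real (exp (- 2 * pi\<^sup>2 * s\<^sup>2 * \<omega>\<^sup>2))"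
    unfolding char_std_normal_distribution by (simp add: power_mult_distrib mult_ac)
  finally show ?thesis .
qed

text \<open>The Gaussian on the left is a multiple of the normal density with standard deviation
  \<open>1 / (2 * pi * s)\<close>, so this is inversion for Gaussians.\<close>

lemma fourier_gaussian_weight:
  assumes s: "s > 0"
  shows "fourier (\<lambda>\<omega>. of_real (exp (- 2 * pi\<^sup>2 * s\<^sup>2 * \<omega>\<^sup>2))) v = of_real (normal_density 0 s v)"
proof -
  define r where "r = 1 / (2 * pi * s)"
  have r: "r > 0" using s by (simp add: r_def)
  have r2: "2 * pi * r\<^sup>2 = 1 / (2 * pi * s\<^sup>2)"
    by (simp add: r_def power2_eq_square)
  have e: "exp (- 2 * pi\<^sup>2 * s\<^sup>2 * \<omega>\<^sup>2) = 1 / sqrt (2 * pi * s\<^sup>2) * normal_density 0 r \<omega>" for \<omega>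
  proof -
    have "- \<omega>\<^sup>2 / (2 * r\<^sup>2) = - 2 * pi\<^sup>2 * s\<^sup>2 * \<omega>\<^sup>2"
      using s by (simp add: r_def field_simps power2_eq_square)
    moreover have "sqrt (2 * pi * r\<^sup>2) = 1 / sqrt (2 * pi * s\<^sup>2)"
      unfolding r2 by (simp add: real_sqrt_divide)
    ultimately show ?thesis
      using s by (simp add: normal_density_def)
  qed
  have "fourier (\<lambda>\<omega>. of_real (exp (- 2 * pi\<^sup>2 * s\<^sup>2 * \<omega>\<^sup>2))) v =
      of_real (1 / sqrt (2 * pi * s\<^sup>2)) * fourier (\<lambda>\<omega>. of_real (normal_density 0 r \<omega>)) v"
    unfolding e fourier_def integral_mult_right_zero[symmetric] by (simp add: mult.assoc)
  also have "\<dots> = of_real (1 / sqrt (2 * pi * s\<^sup>2) * exp (- 2 * pi\<^sup>2 * r\<^sup>2 * v\<^sup>2))"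
    unfolding fourier_normal_density[OF r] by simp
  also have "- 2 * pi\<^sup>2 * r\<^sup>2 * v\<^sup>2 = - (v - 0)\<^sup>2 / (2 * s\<^sup>2)"
    using s by (simp add: r_def field_simps power2_eq_square)
  also have "1 / sqrt (2 * pi * s\<^sup>2) * exp \<dots> = normal_density 0 s v"
    by (simp add: normal_density_def)
  finally show ?thesis .
qed

lemma gaussian_weight_integrable:
  assumes "s > 0"
  shows "integrable lborel (\<lambda>\<omega>::real. exp (- 2 * pi\<^sup>2 * s\<^sup>2 * \<omega>\<^sup>2))"
  using nn_integral_gaussian_finite[of "2 * pi\<^sup>2 * s\<^sup>2"] assms
  by (simp add: integrable_iff_bounded)

lemma nn_integral_normal_density_translate:
  assumes "s > 0"
  shows "(\<integral>\<^sup>+r. ennreal (normal_density 0 s (r - t)) \<partial>lborel) = 1"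
proof -
  have "(\<integral>\<^sup>+r. ennreal (normal_density 0 s (r - t)) \<partial>lborel) = (\<integral>\<^sup>+r. ennreal (normal_density 0 s r) \<partial>lborel)"
    using nn_integral_lborel_translate[of "\<lambda>r. ennreal (normal_density 0 s r)" "- t"] by simp
  also have "\<dots> = 1"
    using assms by (subst nn_integral_eq_integral) auto
  finally show ?thesis .
qed

text \<open>Schur's test for the symmetric kernel \<open>normal_density 0 s (r - t)\<close> of mass \<open>1\<close>: estimate the product
  \<open>|p t| * |p r|\<close> by the mean of the squares.\<close>

lemma nn_integral_normal_density_convolution_le:
  assumes s: "s > 0" and [measurable]: "p \<in> borel_measurable borel"
  shows "(\<integral>\<^sup>+t. \<integral>\<^sup>+r. ennreal (norm (p t :: complex) * norm (p r) * normal_density 0 s (r - t)) \<partial>lborel \<partial>lborel) \<le>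
    (\<integral>\<^sup>+t. ennreal ((norm (p t))\<^sup>2) \<partial>lborel)" (is "?L \<le> ?P")
proof -
  let ?n = "\<lambda>t. ennreal ((norm (p t))\<^sup>2)"
  let ?g = "\<lambda>v. ennreal (normal_density 0 s v)"
  have sym: "(\<integral>\<^sup>+t. ?g (r - t) \<partial>lborel) = 1" for r
    using nn_integral_normal_density_translate[OF s, of r] by (simp add: normal_density_def power2_commute)
  have "ennreal (norm (p t) * norm (p r) * normal_density 0 s (r - t)) \<le>
      ennreal (1/2) * (?n t * ?g (r - t)) + ennreal (1/2) * (?n r * ?g (r - t))" for t r
  proof -
    have "norm (p t) * norm (p r) \<le> 1/2 * (norm (p t))\<^sup>2 + 1/2 * (norm (p r))\<^sup>2"
      using sum_squares_bound[of "norm (p t)" "norm (p r)"] by simp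
    then have "norm (p t) * norm (p r) * normal_density 0 s (r - t) \<le>
        (1/2 * (norm (p t))\<^sup>2 + 1/2 * (norm (p r))\<^sup>2) * normal_density 0 s (r - t)"
      by (intro mult_right_mono) auto
    also have "\<dots> = 1/2 * ((norm (p t))\<^sup>2 * normal_density 0 s (r - t)) + 1/2 * ((norm (p r))\<^sup>2 * normal_density 0 s (r - t))"
      by (simp add: algebra_simps)
    finally have "ennreal (norm (p t) * norm (p r) * normal_density 0 s (r - t)) \<le>
        ennreal (1/2 * ((norm (p t))\<^sup>2 * normal_density 0 s (r - t)) + 1/2 * ((norm (p r))\<^sup>2 * normal_density 0 s (r - t)))"
      by (rule ennreal_leI)
    also have "\<dots> = ennreal (1/2) * (?n t * ?g (r - t)) + ennreal (1/2) * (?n r * ?g (r - t))"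
      by (simp only: ennreal_plus ennreal_mult mult_nonneg_nonneg zero_le_power2 normal_density_nonneg zero_le_divide_1_iff zero_le_numeral)
    finally show ?thesis .
  qed
  then have "?L \<le> (\<integral>\<^sup>+t. \<integral>\<^sup>+r. ennreal (1/2) * (?n t * ?g (r - t)) + ennreal (1/2) * (?n r * ?g (r - t)) \<partial>lborel \<partial>lborel)"
    by (intro nn_integral_mono)
  also have "\<dots> = ennreal (1/2) * (\<integral>\<^sup>+t. \<integral>\<^sup>+r. ?n t * ?g (r - t) \<partial>lborel \<partial>lborel) +
      ennreal (1/2) * (\<integral>\<^sup>+t. \<integral>\<^sup>+r. ?n r * ?g (r - t) \<partial>lborel \<partial>lborel)"
    by (simp add: nn_integral_add nn_integral_cmult)
  also have "(\<integral>\<^sup>+t. \<integral>\<^sup>+r. ?n t * ?g (r - t) \<partial>lborel \<partial>lborel) = ?P"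
    using s by (simp add: nn_integral_cmult nn_integral_normal_density_translate)
  also have "(\<integral>\<^sup>+t. \<integral>\<^sup>+r. ?n r * ?g (r - t) \<partial>lborel \<partial>lborel) = (\<integral>\<^sup>+r. \<integral>\<^sup>+t. ?n r * ?g (r - t) \<partial>lborel \<partial>lborel)"
    by (rule lborel_pair.Fubini') measurable
  also have "\<dots> = ?P"
    using s by (simp add: nn_integral_cmult sym)
  also have "ennreal (1/2) * ?P + ennreal (1/2) * ?P = (ennreal (1/2) + ennreal (1/2)) * ?P"
    by (rule distrib_right[symmetric])
  also have "ennreal (1/2) + ennreal (1/2) = 1"
    by (subst ennreal_plus[symmetric]) auto
  finally show ?thesis by simp
qed

text \<open>With the weight \<open>w\<close> the integral converges absolutely, and two applications of the multiplication
  formula move the transform from \<open>p\<close> onto \<open>w\<close>. This turns the left-hand side into a double integral of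
  \<open>p t * cnj (p r)\<close> against the transform of \<open>w\<close>, which is a normal density.\<close>

lemma nn_integral_fourier_gaussian_weight_le:
  assumes s: "s > 0" and p: "integrable lborel p"
  shows "(\<integral>\<^sup>+\<omega>. ennreal (exp (- 2 * pi\<^sup>2 * s\<^sup>2 * \<omega>\<^sup>2) * (norm (fourier p \<omega>))\<^sup>2) \<partial>lborel) \<le>
    (\<integral>\<^sup>+t. ennreal ((norm (p t))\<^sup>2) \<partial>lborel)"
proof -
  have pm[measurable]: "p \<in> borel_measurable borel"
    using p by (auto dest: borel_measurable_integrable)
  define w where "w \<omega> = exp (- 2 * pi\<^sup>2 * s\<^sup>2 * \<omega>\<^sup>2)" for \<omega>
  have wi: "integrable lborel w"
    unfolding w_def by (rule gaussian_weight_integrable[OF s])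
  have [measurable]: "w \<in> borel_measurable borel"
    unfolding w_def[abs_def] by measurable
  have w0: "w \<omega> \<ge> 0" for \<omega> by (simp add: w_def)
  define N where "N = (LINT t|lborel. norm (p t))"
  have N: "norm (fourier p \<omega>) \<le> N" for \<omega>
    unfolding N_def by (rule norm_fourier_le)
  have N0: "N \<ge> 0" by (simp add: N_def)
  \<comment> \<open>The weighted integral of \<open>|fourier p|\<^sup>2\<close> is the pairing of \<open>q\<close> with \<open>fourier p\<close>.\<close>
  define q where "q \<omega> = of_real (w \<omega>) * cnj (fourier p \<omega>)" for \<omega>
  have cm[measurable]: "(\<lambda>\<omega>. cnj (fourier p \<omega>)) \<in> borel_measurable borel"
    by (rule borel_measurable_continuous_on[of cnj]) (auto intro!: continuous_intros)
  have q: "integrable lborel q"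
  proof (rule Bochner_Integration.integrable_bound)
    show "integrable lborel (\<lambda>\<omega>. N * w \<omega>)" using wi by simp
    show "q \<in> borel_measurable lborel" unfolding q_def[abs_def] by measurable
    show "AE \<omega> in lborel. norm (q \<omega>) \<le> norm (N * w \<omega>)"
    proof (rule AE_I2)
      fix \<omega>
      show "norm (q \<omega>) \<le> norm (N * w \<omega>)"
        using mult_right_mono[OF N w0, of \<omega> \<omega>] w0[of \<omega>] N0 by (simp add: q_def norm_mult abs_mult mult.commute)
    qed
  qed
  have fq: "norm (fourier q t) = norm (LINT r|lborel. p r * of_real (normal_density 0 s (r - t)))" for t
  proof -
    define q' where "q' \<omega> = of_real (w \<omega>) * iexp (- (2 * pi * \<omega> * t))" for \<omega>
    have q': "integrable lborel q'"
      by (rule Bochner_Integration.integrable_bound[OF wi]) (auto simp: q'_def[abs_def] norm_mult)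
    have "cnj (fourier q t) = (LINT \<omega>|lborel. q' \<omega> * fourier p \<omega>)"
    proof -
      have "cnj (q \<omega>) * iexp (- (2 * pi * t * \<omega>)) = q' \<omega> * fourier p \<omega>" for \<omega>
        by (simp add: q_def q'_def mult_ac)
      then show ?thesis
        unfolding cnj_fourier by (simp only:)
    qed
    also have "\<dots> = (LINT r|lborel. p r * fourier q' r)"
      by (rule fourier_multiplication_formula[OF p q'])
    also have "fourier q' = (\<lambda>r. of_real (normal_density 0 s (r - t)))"
    proof
      fix r
      have "fourier q' r = fourier (\<lambda>\<omega>. of_real (w \<omega>)) (r - t)"
        unfolding fourier_def q'_def
        by (intro Bochner_Integration.integral_cong) (auto simp: mult.assoc exp_add[symmetric] algebra_simps)
      then show "fourier q' r = of_real (normal_density 0 s (r - t))"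
        unfolding w_def fourier_gaussian_weight[OF s] .
    qed
    finally show ?thesis
      by (metis complex_mod_cnj)
  qed
  have "(\<integral>\<^sup>+\<omega>. ennreal (w \<omega> * (norm (fourier p \<omega>))\<^sup>2) \<partial>lborel) = ennreal (norm (LINT t|lborel. p t * fourier q t))"
  proof -
    have "integrable lborel (\<lambda>\<omega>. N\<^sup>2 * w \<omega>)" using wi by simp
    then have i: "integrable lborel (\<lambda>\<omega>. w \<omega> * (norm (fourier p \<omega>))\<^sup>2)"
    proof (rule Bochner_Integration.integrable_bound)
      show "AE \<omega> in lborel. norm (w \<omega> * (norm (fourier p \<omega>))\<^sup>2) \<le> norm (N\<^sup>2 * w \<omega>)"
        using N w0 by (intro AE_I2) (auto simp: abs_mult mult.commute intro!: mult_left_mono power_mono)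
    qed measurable
    have "(LINT t|lborel. p t * fourier q t) = (LINT \<omega>|lborel. q \<omega> * fourier p \<omega>)"
      by (rule fourier_multiplication_formula[OF p q, symmetric])
    also have "\<dots> = (LINT \<omega>|lborel. complex_of_real (w \<omega> * (norm (fourier p \<omega>))\<^sup>2))"
      by (intro Bochner_Integration.integral_cong)
        (auto simp: q_def complex_norm_square mult_ac simp del: of_real_power)
    also have "\<dots> = of_real (LINT \<omega>|lborel. w \<omega> * (norm (fourier p \<omega>))\<^sup>2)"
      by (rule integral_complex_of_real)
    finally have "norm (LINT t|lborel. p t * fourier q t) = (LINT \<omega>|lborel. w \<omega> * (norm (fourier p \<omega>))\<^sup>2)"
      using w0 by (simp add: integral_nonneg_AE)
    then show ?thesis
      using i w0 by (subst nn_integral_eq_integral) auto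
  qed
  also have "\<dots> \<le> (\<integral>\<^sup>+t. ennreal (norm (p t * fourier q t)) \<partial>lborel)"
    by (cases "integrable lborel (\<lambda>t. p t * fourier q t)")
      (auto simp: not_integrable_integral_eq intro: integral_norm_bound_ennreal)
  also have "\<dots> \<le> (\<integral>\<^sup>+t. \<integral>\<^sup>+r. ennreal (norm (p t) * norm (p r) * normal_density 0 s (r - t)) \<partial>lborel \<partial>lborel)"
  proof (rule nn_integral_mono)
    fix t
    have "integrable lborel (\<lambda>r. p r * complex_of_real (normal_density 0 s (r - t)))"
    proof (rule Bochner_Integration.integrable_bound)
      show "integrable lborel (\<lambda>r. norm (p r) * (1 / sqrt (2 * pi * s\<^sup>2)))"
        using p by simp
      show "AE r in lborel. norm (p r * complex_of_real (normal_density 0 s (r - t))) \<le> norm (norm (p r) * (1 / sqrt (2 * pi * s\<^sup>2)))"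
      proof (rule AE_I2)
        fix r
        have "normal_density 0 s (r - t) \<le> 1 / sqrt (2 * pi * s\<^sup>2) * 1"
          unfolding normal_density_def by (intro mult_left_mono) auto
        then have "norm (p r) * normal_density 0 s (r - t) \<le> norm (p r) * (1 / sqrt (2 * pi * s\<^sup>2))"
          by (intro mult_left_mono) auto
        moreover have "norm (complex_of_real (normal_density 0 s (r - t))) = normal_density 0 s (r - t)"
          by (simp only: norm_of_real abs_of_nonneg normal_density_nonneg)
        ultimately show "norm (p r * complex_of_real (normal_density 0 s (r - t))) \<le> norm (norm (p r) * (1 / sqrt (2 * pi * s\<^sup>2)))"
          by (simp only: norm_mult) simp
      qed
    qed measurable
    then have "ennreal (norm (fourier q t)) \<le> (\<integral>\<^sup>+r. ennreal (norm (p r * complex_of_real (normal_density 0 s (r - t)))) \<partial>lborel)"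
      unfolding fq by (rule integral_norm_bound_ennreal)
    then have "ennreal (norm (p t)) * ennreal (norm (fourier q t)) \<le>
        ennreal (norm (p t)) * (\<integral>\<^sup>+r. ennreal (norm (p r * complex_of_real (normal_density 0 s (r - t)))) \<partial>lborel)"
      by (rule mult_left_mono) simp
    also have "\<dots> = (\<integral>\<^sup>+r. ennreal (norm (p t) * norm (p r) * normal_density 0 s (r - t)) \<partial>lborel)"
      by (subst nn_integral_cmult[symmetric]) (auto simp: norm_mult ennreal_mult mult.assoc)
    finally show "ennreal (norm (p t * fourier q t)) \<le> \<dots>"
      by (simp add: norm_mult ennreal_mult)
  qed
  also have "\<dots> \<le> (\<integral>\<^sup>+t. ennreal ((norm (p t))\<^sup>2) \<partial>lborel)"
    by (rule nn_integral_normal_density_convolution_le[OF s pm])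
  finally show ?thesis unfolding w_def .
qed

text \<open>The Gaussian weights increase to \<open>1\<close> as \<open>s\<close> tends to \<open>0\<close>, and the bound does not depend on \<open>s\<close>;
  Fatou's lemma removes the weight.\<close>

lemma Plancherel_le:
  assumes p: "integrable lborel p"
  shows "(\<integral>\<^sup>+\<omega>. ennreal ((norm (fourier p \<omega>))\<^sup>2) \<partial>lborel) \<le> (\<integral>\<^sup>+t. ennreal ((norm (p t))\<^sup>2) \<partial>lborel)"
proof -
  have [measurable]: "p \<in> borel_measurable borel"
    using p by (auto dest: borel_measurable_integrable)
  define s where "s n = 1 / (real n + 1)" for n
  have s: "s n > 0" for n by (simp add: s_def)
  define u where "u n \<omega> = ennreal (exp (- 2 * pi\<^sup>2 * (s n)\<^sup>2 * \<omega>\<^sup>2) * (norm (fourier p \<omega>))\<^sup>2)" for n \<omega>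
  have "ennreal ((norm (fourier p \<omega>))\<^sup>2) = liminf (\<lambda>n. u n \<omega>)" for \<omega>
  proof -
    have "s \<longlonglongrightarrow> 0" unfolding s_def by real_asymp
    then have "(\<lambda>n. u n \<omega>) \<longlonglongrightarrow> ennreal (exp (- 2 * pi\<^sup>2 * 0\<^sup>2 * \<omega>\<^sup>2) * (norm (fourier p \<omega>))\<^sup>2)"
      unfolding u_def by (intro tendsto_intros)
    then show ?thesis by (simp add: lim_imp_Liminf)
  qed
  then have "(\<integral>\<^sup>+\<omega>. ennreal ((norm (fourier p \<omega>))\<^sup>2) \<partial>lborel) = (\<integral>\<^sup>+\<omega>. liminf (\<lambda>n. u n \<omega>) \<partial>lborel)"
    by simp
  also have "\<dots> \<le> liminf (\<lambda>n. \<integral>\<^sup>+\<omega>. u n \<omega> \<partial>lborel)"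
    unfolding u_def by (rule nn_integral_liminf) measurable
  also have "\<dots> \<le> (\<integral>\<^sup>+t. ennreal ((norm (p t))\<^sup>2) \<partial>lborel)"
    unfolding u_def by (intro Liminf_le always_eventually allI nn_integral_fourier_gaussian_weight_le s p) auto
  finally show ?thesis .
qed

section \<open>Uniqueness for Fourier transforms\<close>

text \<open>The positive and the negative part of \<open>q\<close> have the same Fourier transform, in particular the same mass
  \<open>m\<close>. Divided by \<open>m\<close> they are densities of probability measures with equal characteristic functions,
  which coincide by Levy's theorem; if \<open>m = 0\<close> both parts vanish.\<close>

lemma fourier_eq_0_imp_AE_eq_0_real:
  fixes q :: "real \<Rightarrow> real"
  assumes q: "integrable lborel q" and 0: "\<And>\<omega>. fourier (\<lambda>t. of_real (q t)) \<omega> = 0"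
  shows "AE t in lborel. q t = 0"
proof -
  have [measurable]: "q \<in> borel_measurable borel"
    using q by (auto dest: borel_measurable_integrable)
  define r n where "r t = max 0 (q t)" and "n t = max 0 (- q t)" for t
  have rn: "r t \<ge> 0" "n t \<ge> 0" "q t = r t - n t" for t
    by (auto simp: r_def n_def)
  have ri: "integrable lborel r" and ni: "integrable lborel n"
    unfolding r_def n_def using q by (auto intro!: integrable_max)
  have [measurable]: "r \<in> borel_measurable borel" "n \<in> borel_measurable borel"
    using ri ni by (auto dest: borel_measurable_integrable)
  have eq: "(LINT t|lborel. r t *\<^sub>R iexp (x * t)) = (LINT t|lborel. n t *\<^sub>R iexp (x * t))" for x
  proof -
    have i: "integrable lborel (\<lambda>t. r t *\<^sub>R iexp (x * t))" "integrable lborel (\<lambda>t. n t *\<^sub>R iexp (x * t))"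
      using Bochner_Integration.integrable_bound[OF ri, of "\<lambda>t. r t *\<^sub>R iexp (x * t)"]
        Bochner_Integration.integrable_bound[OF ni, of "\<lambda>t. n t *\<^sub>R iexp (x * t)"] by auto
    have "0 = fourier (\<lambda>t. of_real (q t)) (x / (2 * pi))"
      using 0 by simp
    also have "\<dots> = (LINT t|lborel. r t *\<^sub>R iexp (x * t) - n t *\<^sub>R iexp (x * t))"
      unfolding fourier_def rn(3)
      by (intro Bochner_Integration.integral_cong) (auto simp: scaleR_conv_of_real algebra_simps)
    also have "\<dots> = (LINT t|lborel. r t *\<^sub>R iexp (x * t)) - (LINT t|lborel. n t *\<^sub>R iexp (x * t))"
      by (rule Bochner_Integration.integral_diff[OF i])
    finally show ?thesis by simp
  qed
  define m where "m = (LINT t|lborel. r t)"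
  have m_n: "(LINT t|lborel. n t) = m"
  proof -
    have "complex_of_real (LINT t|lborel. r t) = complex_of_real (LINT t|lborel. n t)"
      using eq[of 0] by (simp add: scaleR_conv_of_real)
    then show ?thesis by (simp add: m_def)
  qed
  have m0: "m \<ge> 0"
    unfolding m_def using rn by (simp add: integral_nonneg_AE)
  show ?thesis
  proof (cases "m = 0")
    case True
    then have "AE t in lborel. r t = 0" "AE t in lborel. n t = 0"
      using integral_nonneg_eq_0_iff_AE[OF ri] integral_nonneg_eq_0_iff_AE[OF ni] rn m_n by (auto simp: m_def)
    then show ?thesis
      by eventually_elim (simp add: rn(3))
  next
    case False
    with m0 have m: "m > 0" by simp
    have dist: "real_distribution (density lborel (\<lambda>t. ennreal (k t / m)))"
      and ch: "char (density lborel (\<lambda>t. ennreal (k t / m))) = (\<lambda>x. (LINT t|lborel. k t *\<^sub>R iexp (x * t)) / of_real m)"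
      if k: "integrable lborel k" "\<And>t. k t \<ge> 0" "(LINT t|lborel. k t) = m" for k
    proof -
      have [measurable]: "k \<in> borel_measurable borel"
        using k by (auto dest: borel_measurable_integrable)
      have "emeasure (density lborel (\<lambda>t. ennreal (k t / m))) UNIV = (\<integral>\<^sup>+t. ennreal (k t / m) \<partial>lborel)"
        by (simp add: emeasure_density)
      also have "\<dots> = ennreal (LINT t|lborel. k t / m)"
        using k m by (intro nn_integral_eq_integral) auto
      also have "\<dots> = 1"
        using k m by simp
      finally have "prob_space (density lborel (\<lambda>t. ennreal (k t / m)))"
        by (intro prob_spaceI) simp
      then show "real_distribution (density lborel (\<lambda>t. ennreal (k t / m)))"
        by (auto simp: real_distribution_def real_distribution_axioms_def)
      show "char (density lborel (\<lambda>t. ennreal (k t / m))) = (\<lambda>x. (LINT t|lborel. k t *\<^sub>R iexp (x * t)) / of_real m)"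
      proof
        fix x
        have "char (density lborel (\<lambda>t. ennreal (k t / m))) x = (LINT t|lborel. (k t / m) *\<^sub>R iexp (x * t))"
          unfolding char_def using k m by (subst integral_density) auto
        also have "\<dots> = (LINT t|lborel. (k t *\<^sub>R iexp (x * t)) / of_real m)"
          by (intro Bochner_Integration.integral_cong) (auto simp: scaleR_conv_of_real)
        finally show "char (density lborel (\<lambda>t. ennreal (k t / m))) x = (LINT t|lborel. k t *\<^sub>R iexp (x * t)) / of_real m"
          by simp
      qed
    qed
    have "density lborel (\<lambda>t. ennreal (r t / m)) = density lborel (\<lambda>t. ennreal (n t / m))"
      by (intro Levy_uniqueness dist) (use ri ni rn m_n eq in \<open>auto simp: m_def[symmetric] ch\<close>)
    then have "AE t in lborel. ennreal (r t / m) = ennreal (n t / m)"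
      by (intro sigma_finite_measure.density_unique[OF sigma_finite_lborel]) measurable
    then show ?thesis
      by eventually_elim (use rn m in \<open>simp add: rn(3)\<close>)
  qed
qed

lemma fourier_eq_0_imp_AE_eq_0:
  assumes p: "integrable lborel p" and 0: "\<And>\<omega>. fourier p \<omega> = 0"
  shows "AE t in lborel. p t = 0"
proof -
  have re: "AE t in lborel. Re (p t) = 0" if p: "integrable lborel p" and 0: "\<And>\<omega>. fourier p \<omega> = 0" for p
  proof (rule fourier_eq_0_imp_AE_eq_0_real)
    show "integrable lborel (\<lambda>t. Re (p t))" using p by simp
    fix \<omega>
    have cp: "integrable lborel (\<lambda>t. cnj (p t))" using p by simp
    have "fourier (\<lambda>t. cnj (p t)) \<omega> = cnj (fourier p (- \<omega>))"
      unfolding cnj_fourier by (simp add: fourier_def)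
    then have c0: "fourier (\<lambda>t. cnj (p t)) \<omega> = 0"
      using 0 by simp
    have "of_real (Re z) * w = (z * w + cnj z * w) / 2" for z w
      by (simp add: distrib_right[symmetric] complex_add_cnj)
    then have "fourier (\<lambda>t. of_real (Re (p t))) \<omega> =
        (LINT t|lborel. (p t * iexp (2 * pi * \<omega> * t) + cnj (p t) * iexp (2 * pi * \<omega> * t)) / 2)"
      unfolding fourier_def by (simp only:)
    also have "\<dots> = (fourier p \<omega> + fourier (\<lambda>t. cnj (p t)) \<omega>) / 2"
      unfolding fourier_def
      by (subst Bochner_Integration.integral_add[symmetric, OF fourier_integrable[OF p] fourier_integrable[OF cp]]) simp
    also have "\<dots> = 0"
      using 0 c0 by simp
    finally show "fourier (\<lambda>t. of_real (Re (p t))) \<omega> = 0" .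
  qed
  have "fourier (\<lambda>t. - \<i> * p t) \<omega> = 0" for \<omega>
  proof -
    have "fourier (\<lambda>t. - \<i> * p t) \<omega> = - \<i> * fourier p \<omega>"
      unfolding fourier_def by (subst integral_mult_right_zero[symmetric]) (simp only: mult.assoc)
    then show ?thesis using 0 by simp
  qed
  then have "AE t in lborel. Re (- \<i> * p t) = 0"
    using p by (intro re) auto
  with re[OF p 0] show ?thesis
    by eventually_elim (simp add: complex_eq_iff)
qed

section \<open>The Bargmann transform\<close>

text \<open>Gaussians beat exponentials, and a product is dominated by the sum of the squares.\<close>

lemma square_integrable_gaussian_integrable:
  fixes u :: "real \<Rightarrow> complex"
  assumes [measurable]: "u \<in> borel_measurable borel" and u: "(\<integral>\<^sup>+t. ennreal ((norm (u t))\<^sup>2) \<partial>lborel) < \<infinity>"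
  shows "integrable lborel (\<lambda>t. norm (u t) * exp (- pi * t\<^sup>2 + a * \<bar>t\<bar>))"
proof -
  have "norm (u t) * exp (- pi * t\<^sup>2 + a * \<bar>t\<bar>) \<le> (norm (u t))\<^sup>2 + exp (a\<^sup>2 / pi) * exp (- pi * t\<^sup>2)" for t
  proof -
    have "(exp (- pi * t\<^sup>2 + a * \<bar>t\<bar>))\<^sup>2 \<le> exp (a\<^sup>2 / pi + - pi * t\<^sup>2)"
    proof -
      have "a\<^sup>2 / pi + - pi * t\<^sup>2 - 2 * (- pi * t\<^sup>2 + a * \<bar>t\<bar>) = (a - pi * \<bar>t\<bar>)\<^sup>2 / pi"
        by (simp add: power2_diff field_simps) (simp add: power2_eq_square)
      also have "\<dots> \<ge> 0" by simp
      finally show ?thesis by (simp add: exp_double[symmetric])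
    qed
    moreover have "norm (u t) * exp (- pi * t\<^sup>2 + a * \<bar>t\<bar>) \<le> (norm (u t))\<^sup>2 + (exp (- pi * t\<^sup>2 + a * \<bar>t\<bar>))\<^sup>2"
    proof -
      have "0 \<le> norm (u t) * exp (- pi * t\<^sup>2 + a * \<bar>t\<bar>)" by simp
      then show ?thesis
        using sum_squares_bound[of "norm (u t)" "exp (- pi * t\<^sup>2 + a * \<bar>t\<bar>)"] by linarith
    qed
    ultimately show ?thesis by (simp only: exp_add[symmetric])
  qed
  then have "ennreal (norm (u t) * exp (- pi * t\<^sup>2 + a * \<bar>t\<bar>)) \<le>
      ennreal ((norm (u t))\<^sup>2) + ennreal (exp (a\<^sup>2 / pi)) * ennreal (exp (- pi * t\<^sup>2))" for t
    by (simp add: ennreal_mult[symmetric] ennreal_plus[symmetric] ennreal_leI del: ennreal_plus)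
  then have "(\<integral>\<^sup>+t. ennreal (norm (u t) * exp (- pi * t\<^sup>2 + a * \<bar>t\<bar>)) \<partial>lborel) \<le>
      (\<integral>\<^sup>+t. ennreal ((norm (u t))\<^sup>2) + ennreal (exp (a\<^sup>2 / pi)) * ennreal (exp (- pi * t\<^sup>2)) \<partial>lborel)"
    by (rule nn_integral_mono)
  also have "\<dots> = (\<integral>\<^sup>+t. ennreal ((norm (u t))\<^sup>2) \<partial>lborel) + ennreal (exp (a\<^sup>2 / pi)) * (\<integral>\<^sup>+t. ennreal (exp (- pi * t\<^sup>2)) \<partial>(lborel :: real measure))"
    by (subst nn_integral_add) (auto simp: nn_integral_cmult)
  also have "\<dots> < \<infinity>"
    using u nn_integral_gaussian_finite[of pi] by (simp add: ennreal_mult_less_top)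
  finally show ?thesis
    by (simp add: integrable_iff_bounded abs_mult)
qed

text \<open>Expand the exponential and integrate term by term: the moments of \<open>h\<close> are the coefficients of an
  everywhere convergent power series.\<close>

lemma exponential_transform_holomorphic:
  fixes h :: "real \<Rightarrow> complex"
  assumes [measurable]: "h \<in> borel_measurable borel"
    and h: "\<And>a. a \<ge> 0 \<Longrightarrow> integrable lborel (\<lambda>t. norm (h t) * exp (a * \<bar>t\<bar>))"
  shows "(\<lambda>z. LINT t|lborel. h t * exp (of_real (2 * pi * t) * z)) holomorphic_on UNIV"
proof -
  define c where "c n t = h t * of_real ((2 * pi * t) ^ n / fact n)" for n t
  have "(\<lambda>n. (LINT t|lborel. c n t) * z ^ n) sums (LINT t|lborel. h t * exp (of_real (2 * pi * t) * z))" for z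
  proof -
    define f where "f n t = c n t * z ^ n" for n t
    have [measurable]: "f n \<in> borel_measurable borel" for n
      unfolding f_def[abs_def] c_def by measurable
    have nf: "norm (f n t) = norm (h t) * ((2 * pi * norm z * \<bar>t\<bar>) ^ n / fact n)" for n t
      by (simp add: f_def c_def norm_mult norm_divide norm_power power_mult_distrib abs_mult)
    have esum: "(\<lambda>n. (2 * pi * norm z * \<bar>t\<bar>) ^ n / fact n) sums exp (2 * pi * norm z * \<bar>t\<bar>)" for t
      using exp_converges[of "2 * pi * norm z * \<bar>t\<bar>"] by (simp add: field_simps)
    have fs: "(\<lambda>n. f n t) sums (h t * exp (of_real (2 * pi * t) * z))" for t
    proof -
      have "(\<lambda>n. h t * ((of_real (2 * pi * t) * z) ^ n /\<^sub>R fact n)) sums (h t * exp (of_real (2 * pi * t) * z))"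
        by (intro sums_mult exp_converges)
      moreover have "h t * ((of_real (2 * pi * t) * z) ^ n /\<^sub>R fact n) = f n t" for n
        by (simp add: f_def c_def scaleR_conv_of_real power_mult_distrib field_simps)
      ultimately show ?thesis by simp
    qed
    have dom: "integrable lborel (\<lambda>t. norm (h t) * exp (2 * pi * norm z * \<bar>t\<bar>))"
      by (rule h) simp
    have psum: "(\<Sum>i<n. norm (f i t)) \<le> norm (h t) * exp (2 * pi * norm z * \<bar>t\<bar>)" for n t
      unfolding nf sum_distrib_left[symmetric]
      using sum_le_suminf[OF sums_summable[OF esum[of t]], of "{..<n}"] sums_unique[OF esum[of t]]
      by (intro mult_left_mono) auto
    have fi: "integrable lborel (f n)" for n
    proof (rule Bochner_Integration.integrable_bound[OF dom])
      have "norm (f n t) \<le> norm (h t) * exp (2 * pi * norm z * \<bar>t\<bar>)" for t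
        using psum[of t "Suc n"] sum_nonneg[of "{..<n}" "\<lambda>i. norm (f i t)"] by simp
      then show "AE t in lborel. norm (f n t) \<le> norm (norm (h t) * exp (2 * pi * norm z * \<bar>t\<bar>))"
        by (intro AE_I2) (auto simp: abs_mult)
    qed measurable
    have sn: "summable (\<lambda>n. norm (f n t))" for t
      unfolding nf using esum[of t] by (intro summable_mult) (rule sums_summable)
    have "summable (\<lambda>n. LINT t|lborel. norm (f n t))"
    proof (rule summableI_nonneg_bounded)
      fix n
      have "(\<Sum>i<n. (LINT t|lborel. norm (f i t))) = (LINT t|lborel. (\<Sum>i<n. norm (f i t)))"
        using fi by (intro Bochner_Integration.integral_sum[symmetric]) auto
      also have "\<dots> \<le> (LINT t|lborel. norm (h t) * exp (2 * pi * norm z * \<bar>t\<bar>))"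
        using fi by (intro integral_mono dom psum Bochner_Integration.integrable_sum integrable_norm)
      finally show "(\<Sum>i<n. (LINT t|lborel. norm (f i t))) \<le> (LINT t|lborel. norm (h t) * exp (2 * pi * norm z * \<bar>t\<bar>))" .
    qed simp
    then have "(\<lambda>n. LINT t|lborel. f n t) sums (LINT t|lborel. (\<Sum>n. f n t))"
      by (intro sums_integral fi) (use sn in auto)
    moreover have "(\<Sum>n. f n t) = h t * exp (of_real (2 * pi * t) * z)" for t
      using sums_unique[OF fs[of t]] by simp
    moreover have "(LINT t|lborel. f n t) = (LINT t|lborel. c n t) * z ^ n" for n
      by (simp add: f_def)
    ultimately show ?thesis by simp
  qed
  then have "(\<lambda>z. LINT t|lborel. h t * exp (of_real (2 * pi * t) * z)) holomorphic_on ball 0 r" for r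
    by (intro power_series_holomorphic[of 0 r "\<lambda>n. LINT t|lborel. c n t"]) simp
  then have "(\<lambda>z. LINT t|lborel. h t * exp (of_real (2 * pi * t) * z)) field_differentiable at z" for z
    by (rule holomorphic_on_imp_differentiable_at[of _ "ball 0 (norm z + 1)"]) auto
  then show ?thesis
    by (simp add: holomorphic_on_def)
qed

definition bargmann :: "(real \<Rightarrow> complex) \<Rightarrow> complex \<Rightarrow> complex" where
  "bargmann u z = exp (- (of_real pi / 2) * z\<^sup>2) *
     (LINT t|lborel. u t * of_real (exp (- pi * t\<^sup>2)) * exp (of_real (2 * pi * t) * z))"

text \<open>The signal localised at \<open>x\<close> by the Gaussian window; its Fourier transform is the Gabor transform with
  the frequency reflected.\<close>

definition windowed :: "(real \<Rightarrow> complex) \<Rightarrow> real \<Rightarrow> real \<Rightarrow> complex" where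
  "windowed u x t = u t * of_real (exp (- pi * (t - x)\<^sup>2))"

lemma windowed_measurable [measurable]:
  assumes [measurable]: "u \<in> borel_measurable borel"
  shows "windowed u x \<in> borel_measurable borel"
  unfolding windowed_def[abs_def] by measurable

text \<open>Completing the square in the exponent \<open>- pi * t\<^sup>2 + 2 * pi * t * z\<close>.\<close>

lemma bargmann_eq_fourier_windowed:
  "bargmann u (Complex x \<omega>) = exp (of_real pi * of_real (x\<^sup>2) - (of_real pi / 2) * (Complex x \<omega>)\<^sup>2) * fourier (windowed u x) \<omega>"
proof -
  let ?z = "Complex x \<omega>"
  have e: "u t * of_real (exp (- pi * t\<^sup>2)) * exp (of_real (2 * pi * t) * ?z) =
      exp (of_real pi * of_real (x\<^sup>2)) * (windowed u x t * iexp (2 * pi * \<omega> * t))" for t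
  proof -
    have "of_real (- pi * t\<^sup>2) + of_real (2 * pi * t) * ?z =
        of_real pi * of_real (x\<^sup>2) + (of_real (- pi * (t - x)\<^sup>2) + \<i> * of_real (2 * pi * \<omega> * t))"
      by (simp add: complex_eq_iff power2_eq_square algebra_simps)
    then have "complex_of_real (exp (- pi * t\<^sup>2)) * exp (of_real (2 * pi * t) * ?z) =
        exp (of_real pi * of_real (x\<^sup>2)) * (of_real (exp (- pi * (t - x)\<^sup>2)) * iexp (2 * pi * \<omega> * t))"
      by (simp only: exp_of_real[symmetric] exp_add[symmetric])
    then have "u t * of_real (exp (- pi * t\<^sup>2)) * exp (of_real (2 * pi * t) * ?z) =
        u t * (exp (of_real pi * of_real (x\<^sup>2)) * (of_real (exp (- pi * (t - x)\<^sup>2)) * iexp (2 * pi * \<omega> * t)))"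
      by (simp only: mult.assoc)
    also have "\<dots> = exp (of_real pi * of_real (x\<^sup>2)) * (windowed u x t * iexp (2 * pi * \<omega> * t))"
      unfolding windowed_def by (simp only: mult_ac)
    finally show ?thesis .
  qed
  show ?thesis
  proof -
    have "bargmann u ?z = exp (- (of_real pi / 2) * ?z\<^sup>2) *
        (exp (of_real pi * of_real (x\<^sup>2)) * fourier (windowed u x) \<omega>)"
      unfolding bargmann_def e fourier_def integral_mult_right_zero ..
    also have "\<dots> = exp (- (of_real pi / 2) * ?z\<^sup>2 + of_real pi * of_real (x\<^sup>2)) * fourier (windowed u x) \<omega>"
      by (simp only: exp_add mult.assoc)
    also have "- (of_real pi / 2) * ?z\<^sup>2 + of_real pi * of_real (x\<^sup>2) =
        of_real pi * of_real (x\<^sup>2) - (of_real pi / 2) * ?z\<^sup>2"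
      by simp
    finally show ?thesis .
  qed
qed

lemma norm_bargmann:
  "norm (bargmann u (Complex x \<omega>)) = exp (pi / 2 * (norm (Complex x \<omega>))\<^sup>2) * norm (fourier (windowed u x) \<omega>)"
proof -
  have "Re (of_real pi * of_real (x\<^sup>2) - (of_real pi / 2) * (Complex x \<omega>)\<^sup>2) = pi / 2 * (norm (Complex x \<omega>))\<^sup>2"
    unfolding cmod_power2 by (simp add: power2_eq_square field_simps)
  then show ?thesis
    unfolding bargmann_eq_fourier_windowed norm_mult norm_exp_eq_Re by simp
qed

lemma fock_density_bargmann:
  "fock_density (bargmann u) (Complex x \<omega>) = ennreal ((norm (fourier (windowed u x) \<omega>))\<^sup>2)"
proof -
  have "(exp (pi / 2 * (norm (Complex x \<omega>))\<^sup>2))\<^sup>2 * exp (- pi * (norm (Complex x \<omega>))\<^sup>2) = 1"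
    by (simp add: exp_double[symmetric] exp_add[symmetric])
  then show ?thesis
    unfolding fock_density_def norm_bargmann power_mult_distrib by (simp add: mult.commute mult.left_commute)
qed

context
  fixes u :: "real \<Rightarrow> complex"
  assumes um[measurable]: "u \<in> borel_measurable borel" and u2: "(\<integral>\<^sup>+t. ennreal ((norm (u t))\<^sup>2) \<partial>lborel) < \<infinity>"
begin

lemma windowed_integrable: "integrable lborel (windowed u x)"
proof (rule Bochner_Integration.integrable_bound[OF square_integrable_gaussian_integrable[OF um u2, of "2 * pi * \<bar>x\<bar>"]])
  have "norm (windowed u x t) \<le> norm (u t) * exp (- pi * t\<^sup>2 + 2 * pi * \<bar>x\<bar> * \<bar>t\<bar>)" for t
  proof -
    have "x * t \<le> \<bar>x\<bar> * \<bar>t\<bar>"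
      by (metis abs_ge_self abs_mult)
    then have "2 * pi * (x * t) \<le> 2 * pi * (\<bar>x\<bar> * \<bar>t\<bar>)"
      by (intro mult_left_mono) auto
    moreover have "- pi * (t - x)\<^sup>2 = - pi * t\<^sup>2 + 2 * pi * (x * t) - pi * x\<^sup>2"
      by (simp add: power2_eq_square algebra_simps)
    moreover have "0 \<le> pi * x\<^sup>2" by simp
    ultimately have "- pi * (t - x)\<^sup>2 \<le> - pi * t\<^sup>2 + 2 * pi * \<bar>x\<bar> * \<bar>t\<bar>"
      by linarith
    then show ?thesis
      by (simp add: windowed_def norm_mult mult_left_mono)
  qed
  then show "AE t in lborel. norm (windowed u x t) \<le> norm (norm (u t) * exp (- pi * t\<^sup>2 + 2 * pi * \<bar>x\<bar> * \<bar>t\<bar>))"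
    by (intro AE_I2) (auto simp: abs_mult)
qed measurable

lemma bargmann_holomorphic: "bargmann u holomorphic_on UNIV"
proof -
  have "(\<lambda>z. LINT t|lborel. (u t * of_real (exp (- pi * t\<^sup>2))) * exp (of_real (2 * pi * t) * z)) holomorphic_on UNIV"
  proof (rule exponential_transform_holomorphic)
    fix a :: real
    show "integrable lborel (\<lambda>t. norm (u t * of_real (exp (- pi * t\<^sup>2))) * exp (a * \<bar>t\<bar>))"
      using square_integrable_gaussian_integrable[OF um u2, of a]
      by (simp only: norm_mult norm_of_real abs_exp_cancel exp_add mult.assoc)
  qed measurable
  then show ?thesis
    unfolding bargmann_def[abs_def] by (intro holomorphic_intros)
qed

text \<open>By Plancherel's inequality in \<open>\<omega>\<close> and Tonelli's theorem, the energy is at most \<open>\<parallel>u\<parallel>\<^sup>2\<close> times the squared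
  norm of the window.\<close>

lemma fock_energy_bargmann_finite: "fock_energy (bargmann u) < \<infinity>"
proof -
  have [measurable]: "bargmann u \<in> borel_measurable borel"
    by (rule entire_measurable[OF bargmann_holomorphic])
  define g where "g v = ennreal (exp (- (2 * pi) * v\<^sup>2))" for v :: real
  have [measurable]: "g \<in> borel_measurable borel"
    unfolding g_def by measurable
  define n where "n t = ennreal ((norm (u t))\<^sup>2)" for t
  have [measurable]: "n \<in> borel_measurable borel"
    unfolding n_def by measurable
  have gt: "(\<integral>\<^sup>+x. g (t - x) \<partial>lborel) = (\<integral>\<^sup>+x. g x \<partial>lborel)" for t
  proof -
    have "(\<integral>\<^sup>+x. g (t - x) \<partial>lborel) = (\<integral>\<^sup>+x. g (- t + x) \<partial>lborel)"
      by (intro nn_integral_cong) (simp add: g_def power2_commute)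
    also have "\<dots> = (\<integral>\<^sup>+x. g x \<partial>lborel)"
      by (rule nn_integral_lborel_translate) measurable
    finally show ?thesis .
  qed
  have w: "ennreal ((norm (windowed u x t))\<^sup>2) = n t * g (t - x)" for x t
  proof -
    have "(exp (- pi * (t - x)\<^sup>2))\<^sup>2 = exp (- (2 * pi) * (t - x)\<^sup>2)"
      by (simp add: exp_double[symmetric])
    then show ?thesis
      by (simp only: windowed_def norm_mult norm_of_real abs_exp_cancel power_mult_distrib n_def g_def ennreal_mult zero_le_power2 exp_ge_zero)
  qed
  have "fock_energy (bargmann u) = (\<integral>\<^sup>+x. \<integral>\<^sup>+\<omega>. ennreal ((norm (fourier (windowed u x) \<omega>))\<^sup>2) \<partial>lborel \<partial>lborel)"
    unfolding fock_energy_def by (subst nn_integral_lborel_complex) (auto simp: fock_density_bargmann)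
  also have "\<dots> \<le> (\<integral>\<^sup>+x. \<integral>\<^sup>+t. n t * g (t - x) \<partial>lborel \<partial>lborel)"
    unfolding w[symmetric] by (intro nn_integral_mono Plancherel_le windowed_integrable)
  also have "\<dots> = (\<integral>\<^sup>+t. \<integral>\<^sup>+x. n t * g (t - x) \<partial>lborel \<partial>lborel)"
    by (rule lborel_pair.Fubini') measurable
  also have "\<dots> = (\<integral>\<^sup>+t. n t \<partial>lborel) * (\<integral>\<^sup>+x. g x \<partial>lborel)"
    by (simp add: nn_integral_cmult gt nn_integral_multc)
  also have "\<dots> < \<infinity>"
    using u2 nn_integral_gaussian_finite[of "2 * pi"] by (simp add: n_def g_def ennreal_mult_less_top)
  finally show ?thesis .
qed

text \<open>On the imaginary axis the Bargmann transform is the Fourier transform of \<open>u t * exp (- pi * t\<^sup>2)\<close> up to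
  the factor \<open>exp (pi / 2 * \<omega>\<^sup>2)\<close>. If it is constant, that Fourier transform is a Gaussian, which is the
  one of the normal density with variance \<open>1 / (4 * pi)\<close>.\<close>

lemma bargmann_constant_imp_gaussian:
  assumes k: "\<And>z. bargmann u z = k"
  shows "AE t in lborel. u t = (k * of_real (sqrt 2)) * of_real (exp (- pi * t\<^sup>2))"
proof -
  define s where "s = 1 / sqrt (4 * pi)"
  have s: "s > 0" "s\<^sup>2 = 1 / (4 * pi)"
    by (simp_all add: s_def power_divide)
  have nd: "normal_density 0 s t = sqrt 2 * exp (- 2 * pi * t\<^sup>2)" for t
    by (simp add: normal_density_def s real_sqrt_divide mult.commute)
  have f: "fourier (windowed u 0) \<omega> = k * of_real (exp (- (pi / 2) * \<omega>\<^sup>2))" for \<omega>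
  proof -
    have z2: "(Complex 0 \<omega>)\<^sup>2 = - of_real (\<omega>\<^sup>2)"
      by (simp add: complex_eq_iff power2_eq_square)
    have "k = exp (of_real (pi / 2 * \<omega>\<^sup>2)) * fourier (windowed u 0) \<omega>"
      using bargmann_eq_fourier_windowed[of u 0 \<omega>] k[of "Complex 0 \<omega>"] by (simp add: z2)
    then have "exp (of_real (- (pi / 2) * \<omega>\<^sup>2)) * k = (exp (of_real (- (pi / 2) * \<omega>\<^sup>2)) * exp (of_real (pi / 2 * \<omega>\<^sup>2))) * fourier (windowed u 0) \<omega>"
      by (simp only: mult.assoc)
    also have "exp (complex_of_real (- (pi / 2) * \<omega>\<^sup>2)) * exp (of_real (pi / 2 * \<omega>\<^sup>2)) = 1"
      by (simp add: exp_add[symmetric])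
    finally show ?thesis
      by (simp only: exp_of_real mult_1 mult.commute)
  qed
  define D where "D t = windowed u 0 t - k * of_real (normal_density 0 s t)" for t
  have ni: "integrable lborel (\<lambda>t. k * complex_of_real (normal_density 0 s t))"
    using s by (intro integrable_mult_right integrable_of_real integrable_normal_density)
  have "AE t in lborel. D t = 0"
  proof (rule fourier_eq_0_imp_AE_eq_0)
    show "integrable lborel D"
      unfolding D_def by (intro Bochner_Integration.integrable_diff windowed_integrable ni)
    fix \<omega>
    have "fourier D \<omega> = fourier (windowed u 0) \<omega> - fourier (\<lambda>t. k * of_real (normal_density 0 s t)) \<omega>"
      unfolding D_def fourier_def left_diff_distrib
      by (intro Bochner_Integration.integral_diff fourier_integrable windowed_integrable ni)
    also have "fourier (\<lambda>t. k * of_real (normal_density 0 s t)) \<omega> = k * fourier (\<lambda>t. of_real (normal_density 0 s t)) \<omega>"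
      unfolding fourier_def mult.assoc by (rule integral_mult_right_zero)
    also have "\<dots> = k * of_real (exp (- (pi / 2) * \<omega>\<^sup>2))"
      unfolding fourier_normal_density[OF s(1)] s(2) by (simp add: power2_eq_square)
    finally show "fourier D \<omega> = 0"
      by (simp only: f diff_self)
  qed
  then show ?thesis
  proof eventually_elim
    case (elim t)
    have "exp (- 2 * pi * t\<^sup>2) = exp (- pi * t\<^sup>2) * exp (- pi * t\<^sup>2)"
      by (simp add: exp_add[symmetric])
    then have "u t * of_real (exp (- pi * t\<^sup>2)) = (k * of_real (sqrt 2)) * of_real (exp (- pi * t\<^sup>2)) * of_real (exp (- pi * t\<^sup>2))"
      using elim by (simp add: D_def windowed_def nd)
    moreover have "complex_of_real (exp (- pi * t\<^sup>2)) \<noteq> 0"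
      by (simp only: of_real_eq_0_iff exp_not_eq_zero not_False_eq_True)
    ultimately show ?case
      by (rule mult_right_cancel[THEN iffD1, rotated])
  qed
qed

end

section \<open>Gabor transforms with Gaussian decay on a sampling set\<close>

text \<open>Fubini arguments on products of \<open>lborel\<close> need Borel measurable integrands, whereas elements of
  \<open>L2_real\<close> are only Lebesgue measurable.\<close>

lemma L2_real_borel_representative:
  assumes "f \<in> L2_real"
  obtains g where "g \<in> borel_measurable borel" "AE t in lborel. f t = g t"
    "(\<integral>\<^sup>+t. ennreal ((norm (g t))\<^sup>2) \<partial>lborel) < \<infinity>"
proof -
  have fm[measurable]: "f \<in> borel_measurable lebesgue" and fi: "integrable lebesgue (\<lambda>t. (norm (f t))\<^sup>2)"
    using assms by (auto simp: L2_real_def)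
  obtain r where r[measurable]: "r \<in> borel_measurable lborel" "AE t in lborel. Re (f t) = r t"
    using completion_ex_borel_measurable_real[of "\<lambda>t. Re (f t)" lborel] by auto
  obtain i where i[measurable]: "i \<in> borel_measurable lborel" "AE t in lborel. Im (f t) = i t"
    using completion_ex_borel_measurable_real[of "\<lambda>t. Im (f t)" lborel] by auto
  define g where "g t = Complex (r t) (i t)" for t
  have g: "g \<in> borel_measurable borel"
    unfolding g_def Complex_eq using r(1) i(1) by measurable
  have ae: "AE t in lborel. f t = g t"
    using r(2) i(2) by eventually_elim (simp add: g_def complex_eq_iff)
  have "(\<integral>\<^sup>+t. ennreal ((norm (g t))\<^sup>2) \<partial>lborel) = (\<integral>\<^sup>+t. ennreal ((norm (f t))\<^sup>2) \<partial>lborel)"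
    by (rule nn_integral_cong_AE) (use ae in eventually_elim, simp)
  also have "\<dots> = (\<integral>\<^sup>+t. ennreal ((norm (f t))\<^sup>2) \<partial>lebesgue)"
    by (rule nn_integral_completion[symmetric])
  also have "\<dots> < \<infinity>"
    using fi by (simp add: integrable_iff_bounded)
  finally show thesis
    using that g ae by blast
qed

text \<open>Conjugating the signal replaces the frequency \<open>\<omega>\<close> by \<open>- \<omega>\<close> and so makes the Gabor transform at
  \<open>x + \<i> * \<omega>\<close> correspond to the Bargmann transform at the same point of the plane and not at its mirror
  image; the sampling set need not be symmetric.\<close>

lemma cnj_gabor_transform:
  assumes [measurable]: "f \<in> borel_measurable lebesgue" "g \<in> borel_measurable borel" and ae: "AE t in lborel. f t = g t"
  shows "cnj (gabor_transform f x \<omega>) = fourier (windowed (\<lambda>t. cnj (g t)) x) \<omega>"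
proof -
  let ?e = "\<lambda>t. of_real (exp (- pi * (t - x)\<^sup>2)) * exp (- 2 * of_real pi * \<i> * of_real \<omega> * of_real t)"
  have em: "?e \<in> borel_measurable borel" by measurable
  then have [measurable]: "?e \<in> borel_measurable lebesgue"
    by (simp add: measurable_completion)
  have [measurable]: "g \<in> borel_measurable lebesgue"
    using assms(2) by (simp add: measurable_completion)
  have "gabor_transform f x \<omega> = (LINT t|lebesgue. f t * ?e t)"
    unfolding gabor_transform_def by (simp only: mult.assoc)
  also have "\<dots> = (LINT t|lebesgue. g t * ?e t)"
  proof (rule integral_cong_AE)
    show "AE t in lebesgue. f t * ?e t = g t * ?e t"
      using AE_completion[OF ae] by eventually_elim simp
  qed measurable
  also have "\<dots> = (LINT t|lborel. g t * ?e t)"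
    by (rule integral_completion) (use em assms(2) in measurable)
  finally have "cnj (gabor_transform f x \<omega>) = (LINT t|lborel. cnj (g t * ?e t))"
    by (simp only: Bochner_Integration.integral_cnj)
  also have "\<dots> = fourier (windowed (\<lambda>t. cnj (g t)) x) \<omega>"
    unfolding fourier_def windowed_def
    by (intro Bochner_Integration.integral_cong) (auto simp: exp_cnj mult_ac)
  finally show ?thesis .
qed

theorem theorem2p7:
  fixes \<Lambda> :: "complex set" and f :: "real \<Rightarrow> complex"
  assumes "stable_sampling pi \<Lambda>"
    and "f \<in> L2_real"
    and "\<exists>C::real. C \<ge> 0 \<and>
      (\<forall>l\<in>\<Lambda>. norm (gabor_transform f (Re l) (Im l)) \<le> C * exp (- (pi / 2) * (norm l)\<^sup>2))"
  shows "\<exists>c::complex. AE x in lebesgue. f x = c * of_real (exp (- pi * x\<^sup>2))"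
proof -
  obtain A B where "fock_sampling \<Lambda> A B"
    using stable_sampling_imp_fock_sampling[OF assms(1)] .
  then interpret fock_sampling \<Lambda> A B .
  obtain C where C: "\<And>l. l \<in> \<Lambda> \<Longrightarrow> norm (gabor_transform f (Re l) (Im l)) \<le> C * exp (- (pi / 2) * (norm l)\<^sup>2)"
    using assms(3) by blast
  have fm: "f \<in> borel_measurable lebesgue"
    using assms(2) by (simp add: L2_real_def)
  obtain g where g: "g \<in> borel_measurable borel" "AE t in lborel. f t = g t"
    "(\<integral>\<^sup>+t. ennreal ((norm (g t))\<^sup>2) \<partial>lborel) < \<infinity>"
    using L2_real_borel_representative[OF assms(2)] .
  define u where "u t = cnj (g t)" for t
  have u: "u \<in> borel_measurable borel" "(\<integral>\<^sup>+t. ennreal ((norm (u t))\<^sup>2) \<partial>lborel) < \<infinity>"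
    unfolding u_def using g by (auto intro!: borel_measurable_continuous_on[of cnj] continuous_intros)
  have "norm (bargmann u l) \<le> C" if "l \<in> \<Lambda>" for l
  proof -
    have "norm (gabor_transform f (Re l) (Im l)) = norm (fourier (windowed u (Re l)) (Im l))"
      using cnj_gabor_transform[OF fm g(1,2), of "Re l" "Im l"] unfolding u_def by (metis complex_mod_cnj)
    then have "norm (bargmann u l) = exp (pi / 2 * (norm l)\<^sup>2) * norm (gabor_transform f (Re l) (Im l))"
      using norm_bargmann[of u "Re l" "Im l"] by simp
    also have "\<dots> \<le> exp (pi / 2 * (norm l)\<^sup>2) * (C * exp (- (pi / 2) * (norm l)\<^sup>2))"
      by (intro mult_left_mono C that) auto
    also have "\<dots> = C"
      by (simp add: exp_minus)
    finally show ?thesis .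
  qed
  then obtain k where "\<And>z. bargmann u z = k"
    using bounded_on_sampling_set_imp_constant[OF bargmann_holomorphic[OF u] fock_energy_bargmann_finite[OF u]] by blast
  then have "AE t in lborel. u t = (k * of_real (sqrt 2)) * of_real (exp (- pi * t\<^sup>2))"
    by (rule bargmann_constant_imp_gaussian[OF u])
  with g(2) have "AE t in lborel. f t = (cnj k * of_real (sqrt 2)) * of_real (exp (- pi * t\<^sup>2))"
  proof eventually_elim
    case (elim t)
    have "f t = cnj (u t)"
      by (simp only: elim(1) u_def complex_cnj_cnj)
    also have "\<dots> = (cnj k * of_real (sqrt 2)) * of_real (exp (- pi * t\<^sup>2))"
      unfolding elim(2) by simp
    finally show ?case .
  qed
  then show ?thesis
    by (intro exI[of _ "cnj k * of_real (sqrt 2)"] AE_completion)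
qed

end
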